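(* Let $d$ be a prime, let $m\geq 2$ and $n\geq 1$ be integers, and let $c_0$ be a root of $G_{d,m,n}(c)$. Set $K=\mathbb{Q}(c_0)$ with ring of integers $\mathcal{O}_K$. Then $d$ does not divide the index $[\mathcal{O}_K:\mathbb{Z}[c_0]]$.
   Context: For an integer $d\geq 2$ let $f_{c,d}(x)=x^d+c$, and write $f_{c,d}^k$ for the $k$-th iterate ($f_{c,d}^0(x)=x$); $f_{c,d}^k(0)\in\mathbb{Z}[c]$. Let $\mu$ be the Möbius function. For $m\geq 1$ set $$F_{d,m,n}(c)=\prod_{k\mid n}\left(\frac{f_{c,d}^{m+k}(0)-f_{c,d}^m(0)}{f_{c,d}^{m-1+k}(0)-f_{c,d}^{m-1}(0)}\right)^{\mu(n/k)},$$ and for $m\geq 2$ define $G_{d,m,n}(c)=F_{d,m,n}(c)$ if $n\nmid m-1$, and $G_{d,m,n}(c)=F_{d,m,n}(c)/F_{d,1,n}(c)$ if $n\mid m-1$. These are monic polynomials in $\mathbb{Z}[c]$, so $c_0$ is an algebraic integer. *)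

theory Defs
  imports
    Complex_Main
    "HOL-Computational_Algebra.Computational_Algebra"
    "HOL-Algebra.Generated_Fields"
    "HOL-Algebra.AbelCoset"
    "HOL-Algebra.Algebraic_Closure_Type"
begin

definition moebius_mu :: "nat \<Rightarrow> int" where
  "moebius_mu n = (if squarefree n then (- 1) ^ card (prime_factors n) else 0)"

definition unicritical :: "'a :: comm_semiring_1 \<Rightarrow> nat \<Rightarrow> 'a \<Rightarrow> 'a" where
  "unicritical c d x = x ^ d + c"

text \<open>The parameter \<open>c\<close> is the indeterminate of \<open>\<int>[c]\<close>.\<close>

definition crit_orbit :: "nat \<Rightarrow> nat \<Rightarrow> int poly" where
  "crit_orbit d k = (unicritical [:0, 1:] d ^^ k) 0"

text \<open>
  \<open>F_fract\<close> and \<open>G_fract\<close> live in the field of fractions of \<open>\<int>[c]\<close>, because the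
  Moebius exponents may be negative. They are meant for \<open>m \<ge> 1\<close> and \<open>m \<ge> 2\<close>,
  respectively, with \<open>d \<ge> 2\<close> and \<open>n \<ge> 1\<close>; then all denominators are nonzero.
\<close>

definition F_fract :: "nat \<Rightarrow> nat \<Rightarrow> nat \<Rightarrow> int poly fract" where
  "F_fract d m n =
     (\<Prod>k | k dvd n.
        (to_fract (crit_orbit d (m + k) - crit_orbit d m) /
         to_fract (crit_orbit d (m - 1 + k) - crit_orbit d (m - 1)))
        powi moebius_mu (n div k))"

definition G_fract :: "nat \<Rightarrow> nat \<Rightarrow> nat \<Rightarrow> int poly fract" where
  "G_fract d m n =
     (if n dvd m - 1 then F_fract d m n / F_fract d 1 n else F_fract d m n)"

text \<open>
  \<open>G_fract d m n\<close> is in fact a polynomial; \<open>to_fract\<close> is injective, so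
  \<open>G_poly d m n\<close> is that polynomial.
\<close>

definition G_poly :: "nat \<Rightarrow> nat \<Rightarrow> nat \<Rightarrow> int poly" where
  "G_poly d m n = (THE P. to_fract P = G_fract d m n)"

abbreviation complex_field :: "complex ring" where
  "complex_field \<equiv> ring_of_type_algebra"

definition rat_adjoin :: "complex \<Rightarrow> complex set" where
  "rat_adjoin x = generate_field complex_field {x}"

definition int_adjoin :: "complex \<Rightarrow> complex set" where
  "int_adjoin x = generate_ring complex_field {x}"

definition ring_of_integers :: "complex set \<Rightarrow> complex set" where
  "ring_of_integers K = {x \<in> K. algebraic_int x}"

text \<open>
  The index of the additive subgroup \<open>B\<close> in \<open>A\<close>. An infinite index is represented by \<open>0\<close>,
  which every number divides; hence non-divisibility of \<open>add_index A B\<close> includes its finiteness.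
\<close>

definition add_index :: "complex set \<Rightarrow> complex set \<Rightarrow> nat" where
  "add_index A B = card (a_rcosets\<^bsub>complex_field\<lparr>carrier := A\<rparr>\<^esub> B)"

end

theory Submission
  imports Defs "HOL-Algebra.Sylow" "Jordan_Normal_Form.Char_Poly"
begin

text \<open>
  Write \<open>p = d\<close>, \<open>a\<^sub>k\<close> for the \<open>k\<close>-th point of the critical orbit, \<open>G\<close> for \<open>G_poly p m n\<close> and
  \<open>A\<close> for the primitive part of \<open>a\<^sub>n\<close>, the product of \<open>a\<^sub>k ^ \<mu>(n/k)\<close> over \<open>k dvd n\<close>.
  The derivative of the map vanishes modulo \<open>p\<close>, so a prime of \<open>\<int>[c]\<close> divides
  \<open>a\<^bsub>m+k\<^esub> - a\<^sub>m\<close> to the same order for all multiples \<open>k\<close> of its period; hence the Moebius products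
  are polynomials.

  Three facts hold. By Frobenius, a power of \<open>A\<close> lies in \<open>(p, G)\<close>. Expanding
  \<open>(x^p - y^p) / (x - y)\<close> at \<open>x \<equiv> y\<close> shows that \<open>p R\<close> lies in \<open>(G, A)\<close> for some unit \<open>R\<close> modulo \<open>(p, A)\<close>.
  Finally \<open>a\<^sub>n^p - a\<^sub>n \<equiv> c^(p^n) - c\<close> modulo \<open>p\<close>, so \<open>z^(p^n) \<equiv> z\<close> modulo \<open>(p, A)\<close> for all \<open>z\<close>.
  Thus at every prime above \<open>p\<close> the maximal ideal of \<open>\<int>[c\<^sub>0]\<close> is generated by \<open>A(c\<^sub>0)\<close>, and an algebraic
  integer \<open>x\<close> with \<open>p x \<in> \<int>[c\<^sub>0]\<close> already lies in \<open>\<int>[c\<^sub>0]\<close>. Since the index is finite, Cauchy's theorem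
  for the quotient group gives the claim.
\<close>

section \<open>Differences along the critical orbit\<close>

text \<open>Taylor expansion at \<open>y\<close> to second order, with an unspecified remainder
  \<open>w\<close>. For \<open>n = d\<close> the linear term is a multiple of \<open>d\<close>,
  which is the source of the factor \<open>d\<close> in the expansions of iterates below.\<close>

lemma power_diff_expand:
  fixes x y :: "'a::comm_ring_1"
  shows "\<exists>w. x ^ n - y ^ n = (x - y) * (of_nat n * y ^ (n - 1) + (x - y) * w)"
proof (induction n)
  case (Suc n)
  then obtain w where w: "x ^ n - y ^ n = (x - y) * (of_nat n * y ^ (n - 1) + (x - y) * w)" by blast
  have yn: "of_nat n * y ^ (n - 1) * y = of_nat n * y ^ n"
    by (cases n) (simp_all add: algebra_simps)
  have "x ^ Suc n - y ^ Suc n = (x - y) * (x ^ n - y ^ n) + (x ^ n - y ^ n) * y + (x - y) * y ^ n"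
    by (simp add: algebra_simps)
  also have "\<dots> = (x - y) * ((x - y) * (of_nat n * y ^ (n - 1) + (x - y) * w))
      + (x - y) * (of_nat n * y ^ (n - 1) * y + (x - y) * w * y) + (x - y) * y ^ n"
    unfolding w by (simp add: algebra_simps)
  also have "\<dots> = (x - y) * (of_nat (Suc n) * y ^ (Suc n - 1)
      + (x - y) * (of_nat n * y ^ (n - 1) + (x - y) * w + w * y))"
    unfolding yn by (simp add: algebra_simps)
  finally show ?case by blast
qed (auto intro: exI[of _ 0])

lemma power_diff_dvd: "(x - y :: 'a::comm_ring_1) dvd x ^ n - y ^ n"
  using power_diff_expand[of x n y] by auto

lemma lead_coeff_diff_less:
  fixes f g :: "'a::ab_group_add poly"
  assumes "degree g < degree f"
  shows "lead_coeff (f - g) = lead_coeff f" "degree (f - g) = degree f"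
proof -
  show deg: "degree (f - g) = degree f"
    using assms degree_add_eq_left[of "- g" f] by simp
  show "lead_coeff (f - g) = lead_coeff f"
    unfolding deg using assms by (simp add: coeff_eq_0)
qed

text \<open>Modulo a non-unit \<open>q\<close>, multiplication by \<open>f\<close> raises degrees by
  exactly \<open>degree f\<close>, because the leading coefficient of \<open>f\<close> is a unit. So
  a product with \<open>f\<close> cannot reduce to the constant 1.\<close>

lemma monic_not_unit_mod_const:
  fixes f s u :: "int poly" and q :: int
  assumes lc: "\<bar>lead_coeff f\<bar> = 1" and deg: "degree f > 0" and q: "\<not> is_unit q"
  shows "f * s \<noteq> 1 + [:q:] * u"
proof
  assume eq: "f * s = 1 + [:q:] * u"
  have fin: "finite {i. \<not> q dvd coeff s i}"
    by (rule finite_subset[of _ "{..degree s}"]) (auto simp: coeff_eq_0 intro: leI)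
  have ne: "{i. \<not> q dvd coeff s i} \<noteq> {}"
  proof
    assume "{i. \<not> q dvd coeff s i} = {}"
    then have "[:q:] dvd s" by (auto simp: const_poly_dvd_iff)
    then have "[:q:] dvd (1 + [:q:] * u) - [:q:] * u" unfolding eq[symmetric]
      by (intro dvd_diff) (auto intro: dvd_triv_left simp del: mult_pCons_left)
    then have "[:q:] dvd 1" by (metis add_diff_cancel_right')
    then have "q dvd coeff 1 0" by (metis const_poly_dvd_iff)
    then show False using q by simp
  qed
  \<comment> \<open>\<open>i\<close> is the degree of \<open>s\<close> modulo \<open>q\<close>, and
    \<open>N\<close> below is therefore the degree of \<open>f * s\<close> modulo
    \<open>q\<close>.\<close>
  define i where "i = Max {i. \<not> q dvd coeff s i}"
  have i: "\<not> q dvd coeff s i" and imax: "\<And>j. j > i \<Longrightarrow> q dvd coeff s j"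
    using Max_in[OF fin ne] Max_ge[OF fin] unfolding i_def by (auto simp: not_le[symmetric])
  define N where "N = degree f + i"
  have "coeff (f * s) N = (\<Sum>j\<le>N. coeff f j * coeff s (N - j))" by (simp add: coeff_mult)
  also have "\<dots> = lead_coeff f * coeff s i + (\<Sum>j\<in>{..N} - {degree f}. coeff f j * coeff s (N - j))"
    by (subst sum.remove[of _ "degree f"]) (auto simp: N_def)
  finally have c: "coeff (f * s) N = \<dots>" .
  have "q dvd (\<Sum>j\<in>{..N} - {degree f}. coeff f j * coeff s (N - j))"
  proof (rule dvd_sum)
    fix j assume j: "j \<in> {..N} - {degree f}"
    show "q dvd coeff f j * coeff s (N - j)"
    proof (cases "j < degree f")
      case True
      then have "N - j > i" by (simp add: N_def)
      then show ?thesis using imax by auto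
    next
      case False
      then show ?thesis using j by (auto simp: coeff_eq_0)
    qed
  qed
  moreover have "q dvd coeff (f * s) N"
    unfolding eq using deg by (simp add: N_def)
  ultimately have "q dvd lead_coeff f * coeff s i"
    unfolding c by (metis dvd_add_left_iff)
  then have "q dvd coeff s i" using lc by (auto simp: abs_if split: if_splits)
  then show False using i by simp
qed

lemma crit_orbit_0 [simp]: "crit_orbit d 0 = 0"
  and crit_orbit_Suc: "crit_orbit d (Suc k) = crit_orbit d k ^ d + [:0, 1:]"
  by (simp_all add: crit_orbit_def unicritical_def)

lemma crit_orbit_add:
  "crit_orbit d (j + k) = (unicritical [:0, 1:] d ^^ k) (crit_orbit d j)"
  by (induction k) (simp_all add: crit_orbit_Suc unicritical_def)

lemma unicritical_iterate_diff_dvd: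
  fixes x y c :: "'a::comm_ring_1"
  shows "x - y dvd (unicritical c d ^^ k) x - (unicritical c d ^^ k) y"
proof (induction k)
  case (Suc k)
  then show ?case
    using power_diff_dvd[of "(unicritical c d ^^ k) x" "(unicritical c d ^^ k) y" d]
    by (auto simp: unicritical_def[of _ _ "(unicritical c d ^^ k) _"] intro: dvd_trans)
qed simp

text \<open>The last of the \<open>k\<close> applications of the map is expanded by
  \<open>power_diff_expand\<close>; the earlier ones only contribute the factor \<open>t\<close>.
  One application suffices to put the factor \<open>d\<close> into the linear term.\<close>

lemma unicritical_iterate_diff_expand:
  fixes x y c :: "'a::comm_ring_1"
  assumes "k > 0"
  shows "\<exists>u w. (unicritical c d ^^ k) x - (unicritical c d ^^ k) y
    = (x - y) * (of_nat d * u + (x - y) * w)"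
proof -
  obtain j where k: "k = Suc j" using assms by (cases k) auto
  define x' y' where "x' = (unicritical c d ^^ j) x" and "y' = (unicritical c d ^^ j) y"
  obtain t where t: "x' - y' = (x - y) * t"
    using unicritical_iterate_diff_dvd[of x y j c d] unfolding x'_def y'_def by (rule dvdE)
  obtain w where "x' ^ d - y' ^ d = (x' - y') * (of_nat d * y' ^ (d - 1) + (x' - y') * w)"
    using power_diff_expand[of x' d y'] by blast
  then have "(unicritical c d ^^ k) x - (unicritical c d ^^ k) y
      = (x - y) * (of_nat d * (t * y' ^ (d - 1)) + (x - y) * (t * t * w))"
    unfolding t by (simp add: k unicritical_def flip: x'_def y'_def) (simp add: algebra_simps)
  then show ?thesis by blast
qed

text \<open>For \<open>k > 0\<close> its roots are the parameters at which the point at time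
  \<open>m\<close> of the critical orbit is periodic with period dividing \<open>k\<close>.\<close>

definition orbit_diff :: "nat \<Rightarrow> nat \<Rightarrow> nat \<Rightarrow> int poly" where
  "orbit_diff d m k = crit_orbit d (m + k) - crit_orbit d m"

lemma orbit_diff_0 [simp]: "orbit_diff d 0 k = crit_orbit d k"
  and orbit_diff_0_right [simp]: "orbit_diff d m 0 = 0"
  by (simp_all add: orbit_diff_def)

text \<open>The right-hand side is the difference of the \<open>k\<close>-th iterates of the two
  points whose difference stands on the left.\<close>

lemma orbit_diff_dvd_shift:
  "orbit_diff d m N dvd orbit_diff d m (k + N) - orbit_diff d m k"
  using unicritical_iterate_diff_dvd[of "crit_orbit d (m + N)" "crit_orbit d m" k "[:0, 1:]" d]
  by (simp add: orbit_diff_def ac_simps flip: crit_orbit_add)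

lemma orbit_diff_dvd_mono:
  assumes "m \<le> m'"
  shows "orbit_diff d m N dvd orbit_diff d m' N"
  using unicritical_iterate_diff_dvd[of "crit_orbit d (m + N)" "crit_orbit d m" "m' - m" "[:0, 1:]" d] assms
  by (simp add: orbit_diff_def ac_simps flip: crit_orbit_add)

text \<open>The difference over \<open>j * N\<close> steps telescopes into \<open>j\<close> blocks
  of length \<open>N\<close>. The first block contributes the 1; each later one is the image of the
  first under a positive number of iterations, so its linear term is a multiple of
  \<open>d\<close>.\<close>

lemma orbit_diff_multiple:
  assumes "j > 0" "N > 0"
  shows "\<exists>u w. orbit_diff d m (j * N)
    = orbit_diff d m N * (1 + of_nat d * u + orbit_diff d m N * w)"
  using assms(1)
proof (induction j rule: nat_induct_non_zero)
  case 1
  show ?case by (auto intro!: exI[of _ 0])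
next
  case (Suc j)
  then obtain u w where uw: "orbit_diff d m (j * N)
    = orbit_diff d m N * (1 + of_nat d * u + orbit_diff d m N * w)" by blast
  obtain u' w' where uw': "crit_orbit d (m + N + j * N) - crit_orbit d (m + j * N)
    = orbit_diff d m N * (of_nat d * u' + orbit_diff d m N * w')"
    using unicritical_iterate_diff_expand[of "j * N" "[:0, 1:]" d "crit_orbit d (m + N)" "crit_orbit d m"]
      Suc.hyps assms(2) unfolding orbit_diff_def crit_orbit_add[symmetric] by auto
  have "orbit_diff d m (Suc j * N)
      = orbit_diff d m (j * N) + (crit_orbit d (m + N + j * N) - crit_orbit d (m + j * N))"
    by (simp add: orbit_diff_def ac_simps)
  also have "\<dots> = orbit_diff d m N * (1 + of_nat d * (u + u') + orbit_diff d m N * (w + w'))"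
    unfolding uw uw' by (simp add: algebra_simps)
  finally show ?case by blast
qed

lemma crit_orbit_degree:
  assumes "d \<ge> 2"
  shows "degree (crit_orbit d (Suc k)) = d ^ k" "lead_coeff (crit_orbit d (Suc k)) = 1"
proof (induction k)
  case 0
  { case 1 then show ?case using assms by (simp add: crit_orbit_Suc power_0_left) }
  { case 2 then show ?case using assms by (simp add: crit_orbit_Suc power_0_left) }
next
  case (Suc k)
  have deg: "degree (crit_orbit d (Suc k) ^ d) = d ^ Suc k"
    using Suc by (subst degree_power_eq) auto
  have gt: "degree (- [:0, 1 :: int:]) < degree (crit_orbit d (Suc k) ^ d)"
    unfolding deg using assms one_less_power[of d "Suc k"] by simp
  have lc: "lead_coeff (crit_orbit d (Suc k) ^ d) = 1"
    unfolding lead_coeff_power using Suc(2) by simp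
  have eq: "crit_orbit d (Suc (Suc k)) = crit_orbit d (Suc k) ^ d - (- [:0, 1:])"
    by (simp add: crit_orbit_Suc)
  { case 1 show ?case unfolding eq lead_coeff_diff_less[OF gt] deg .. }
  { case 2 show ?case unfolding eq lead_coeff_diff_less(1)[OF gt] lc .. }
qed

lemma orbit_diff_monic:
  assumes "d \<ge> 2" "k > 0"
  shows "degree (orbit_diff d m k) > 0" "lead_coeff (orbit_diff d m k) = 1"
proof -
  obtain j where mk: "m + k = Suc j" using assms by (cases "m + k") auto
  have lt: "degree (crit_orbit d m) < degree (crit_orbit d (m + k))"
  proof (cases m)
    case 0
    then show ?thesis using assms unfolding mk by (simp add: crit_orbit_degree)
  next
    case (Suc i)
    then have "i < j" using mk assms by simp
    then show ?thesis using assms unfolding mk Suc by (simp add: crit_orbit_degree)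
  qed
  have lc: "lead_coeff (crit_orbit d (m + k)) = 1"
    unfolding mk using crit_orbit_degree(2)[OF assms(1)] .
  show "degree (orbit_diff d m k) > 0"
    unfolding orbit_diff_def lead_coeff_diff_less[OF lt] using lt by simp
  show "lead_coeff (orbit_diff d m k) = 1"
    unfolding orbit_diff_def lead_coeff_diff_less(1)[OF lt] lc ..
qed

lemma orbit_diff_nonzero [simp]:
  assumes "d \<ge> 2" "k > 0"
  shows "orbit_diff d m k \<noteq> 0"
  using orbit_diff_monic[OF assms, of m] by auto

section \<open>Exact periods modulo a polynomial, and multiplicities of its primes\<close>

definition exact_period :: "nat \<Rightarrow> int poly \<Rightarrow> nat \<Rightarrow> nat \<Rightarrow> bool" where
  "exact_period d f m N \<longleftrightarrow> N > 0 \<and> f dvd orbit_diff d m N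
     \<and> (\<forall>k. 0 < k \<and> k < N \<longrightarrow> \<not> f dvd orbit_diff d m k)"

lemma exact_period_ex:
  assumes "k > 0" "f dvd orbit_diff d m k"
  shows "\<exists>N. exact_period d f m N"
proof -
  let ?Q = "\<lambda>N. N > 0 \<and> f dvd orbit_diff d m N"
  have "?Q (LEAST N. ?Q N)" using assms LeastI[of ?Q k] by blast
  then show ?thesis unfolding exact_period_def using not_less_Least[of _ ?Q] by blast
qed

lemma dvd_orbit_diff_add_iff:
  assumes "f dvd orbit_diff d m N"
  shows "f dvd orbit_diff d m (k + N) \<longleftrightarrow> f dvd orbit_diff d m k"
proof -
  have "f dvd orbit_diff d m (k + N) - orbit_diff d m k"
    using assms orbit_diff_dvd_shift dvd_trans by blast
  then show ?thesis by (metis diff_add_cancel dvd_add_right_iff)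
qed

lemma dvd_orbit_diff_mod_iff:
  assumes "f dvd orbit_diff d m N"
  shows "f dvd orbit_diff d m k \<longleftrightarrow> f dvd orbit_diff d m (k mod N)"
proof -
  have "f dvd orbit_diff d m (r + q * N) \<longleftrightarrow> f dvd orbit_diff d m r" for r q
    by (induction q) (use dvd_orbit_diff_add_iff[OF assms, of "r + _ * N"] in \<open>simp_all add: ac_simps\<close>)
  from this[of "k mod N" "k div N"] show ?thesis by (simp add: mod_mult_div_eq ac_simps)
qed

lemma exact_period_dvd_iff:
  assumes "exact_period d f m N"
  shows "f dvd orbit_diff d m k \<longleftrightarrow> N dvd k"
proof -
  have "f dvd orbit_diff d m k \<longleftrightarrow> f dvd orbit_diff d m (k mod N)"
    using assms dvd_orbit_diff_mod_iff unfolding exact_period_def by blast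
  also have "\<dots> \<longleftrightarrow> k mod N = 0"
    using assms unfolding exact_period_def by (cases "k mod N = 0") auto
  finally show ?thesis by (simp add: dvd_eq_mod_eq_0)
qed

lemma prime_dvd_orbit_diff_monic:
  assumes "d \<ge> 2" "k > 0" "prime_elem f" "f dvd orbit_diff d m k"
  shows "\<bar>lead_coeff f\<bar> = 1" "degree f > 0"
proof -
  obtain g where g: "orbit_diff d m k = f * g" using assms by blast
  have "lead_coeff f * lead_coeff g = 1"
    using orbit_diff_monic(2)[OF assms(1,2), of m] unfolding g by (simp add: lead_coeff_mult)
  then show lc: "\<bar>lead_coeff f\<bar> = 1" by (metis dvd_triv_left zdvd1_eq abs_1 zdvd1_eq)
  show "degree f > 0"
  proof (rule ccontr)
    assume "\<not> degree f > 0"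
    then obtain c where "f = [:c:]" by (metis degree_0_id not_gr0 degree_eq_zeroE)
    then have "is_unit f" using lc by (simp add: is_unit_const_poly_iff)
    then show False using assms(3) by (simp add: prime_elem_def)
  qed
qed

text \<open>For a multiple \<open>k\<close> of the period, \<open>orbit_diff_multiple\<close> leaves
  a cofactor congruent to \<open>1 + d * u\<close> modulo \<open>f\<close>. If \<open>f\<close>
  divided it, then \<open>f\<close> would be invertible modulo \<open>d\<close>, against
  \<open>monic_not_unit_mod_const\<close>.\<close>

lemma multiplicity_orbit_diff:
  assumes "d \<ge> 2" "prime_elem f" "exact_period d f m N" "k > 0"
  shows "multiplicity f (orbit_diff d m k)
    = (if N dvd k then multiplicity f (orbit_diff d m N) else 0)"
proof (cases "N dvd k")
  case True
  then obtain j where k: "k = j * N" by (metis dvdE mult.commute)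
  have N: "N > 0" "f dvd orbit_diff d m N" using assms unfolding exact_period_def by auto
  have j: "j > 0" using k assms by (cases j) auto
  obtain u w where uw: "orbit_diff d m k
      = orbit_diff d m N * (1 + of_nat d * u + orbit_diff d m N * w)"
    using orbit_diff_multiple[OF j N(1)] unfolding k by blast
  have nd: "\<not> f dvd 1 + of_nat d * u + orbit_diff d m N * w"
  proof
    assume "f dvd 1 + of_nat d * u + orbit_diff d m N * w"
    then have "f dvd 1 + of_nat d * u" using N by (metis dvd_add_left_iff dvd_mult2)
    then obtain s where "f * s = 1 + [:int d:] * u" by (metis dvdE of_nat_poly)
    then show False
      using monic_not_unit_mod_const[of f "int d" s u]
        prime_dvd_orbit_diff_monic[OF assms(1) N(1) assms(2) N(2)] assms(1) by simp
  qed
  then have ne: "1 + of_nat d * u + orbit_diff d m N * w \<noteq> 0" by auto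
  show ?thesis
    unfolding uw using True assms(1,2) N(1) nd ne
    by (simp add: prime_elem_multiplicity_mult_distrib not_dvd_imp_multiplicity_0)
next
  case False
  then show ?thesis using exact_period_dvd_iff[OF assms(3)] by (simp add: not_dvd_imp_multiplicity_0)
qed

text \<open>Modulo \<open>f\<close> the point at time \<open>m\<close> already lies on a cycle, and
  all points of a cycle have the same exact period.\<close>

lemma exact_period_mono:
  assumes "exact_period d f m n" "m \<le> m'"
  shows "exact_period d f m' n"
proof -
  have n: "n > 0" "f dvd orbit_diff d m n" using assms unfolding exact_period_def by auto
  have fn: "f dvd orbit_diff d j n" if "m \<le> j" for j
    using n orbit_diff_dvd_mono[OF that] dvd_trans by blast
  have iter: "f dvd orbit_diff d m (i * n)" for i
    using exact_period_dvd_iff[OF assms(1)] by simp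
  have "n dvd k" if "f dvd orbit_diff d m' k" for k
  proof -
    \<comment> \<open>Transport the period \<open>k\<close> of the point at time \<open>m'\<close> back to time \<open>m\<close> along the cycle.\<close>
    define i where "i = m' - m"
    have le: "m' \<le> m + i * n" using n(1) assms(2) by (cases n) (auto simp: i_def)
    have "f dvd orbit_diff d (m + i * n) k" using that orbit_diff_dvd_mono[OF le] dvd_trans by blast
    moreover have "f dvd orbit_diff d (m + k) (i * n)"
      using iter[of i] orbit_diff_dvd_mono[of m "m + k" d "i * n"] dvd_trans by auto
    moreover have "orbit_diff d m k
        = orbit_diff d (m + i * n) k - orbit_diff d (m + k) (i * n) + orbit_diff d m (i * n)"
      by (simp add: orbit_diff_def ac_simps)
    ultimately have "f dvd orbit_diff d m k" using iter[of i] by (auto intro!: dvd_add dvd_diff)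
    then show ?thesis using exact_period_dvd_iff[OF assms(1)] by simp
  qed
  then show ?thesis unfolding exact_period_def using n(1) fn[OF assms(2)]
    by (auto dest!: nat_dvd_not_less)
qed

section \<open>Primitive parts of the Moebius products\<close>

lemma moebius_mu_1 [simp]: "moebius_mu (Suc 0) = 1"
  by (simp add: moebius_mu_def)

lemma moebius_mu_range: "moebius_mu n \<in> {-1, 0, 1}"
  by (auto simp: moebius_mu_def minus_one_power_iff)

lemma squarefree_prime_mult_iff:
  assumes "prime (q::nat)" "\<not> q dvd k"
  shows "squarefree (q * k) \<longleftrightarrow> squarefree k"
proof -
  have "coprime q k" using assms by (simp add: prime_imp_coprime)
  then show ?thesis using assms squarefree_prime[of q] squarefree_multD(2)[of q k]
    by (auto intro: squarefree_mult_coprime)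
qed

lemma moebius_mu_prime_mult:
  assumes "prime q" "\<not> q dvd k" "k > 0"
  shows "moebius_mu (q * k) = - moebius_mu k"
proof -
  have "prime_factors (q * k) = insert q (prime_factors k)" "q \<notin> prime_factors k"
    using assms by (auto simp: prime_factors_product prime_prime_factors)
  then show ?thesis using squarefree_prime_mult_iff[OF assms(1,2)]
    by (simp add: moebius_mu_def)
qed

text \<open>For a prime \<open>q\<close> dividing \<open>n\<close>, the squarefree divisors prime to
  \<open>q\<close> are paired with their products by \<open>q\<close>, and the two terms of each
  pair cancel.\<close>

lemma sum_moebius_mu_divisors:
  assumes "n > 0"
  shows "(\<Sum>k | k dvd n. moebius_mu k) = (if n = 1 then 1 else 0)"
proof (cases "n = 1")
  case False
  obtain q where q: "prime q" "q dvd n" using False prime_factor_nat by blast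
  define S where "S = {k. k dvd n \<and> squarefree k}"
  have fin: "finite S" using assms by (auto simp: S_def intro: finite_subset[OF _ finite_divisors_nat])
  have pos: "k > 0" if "k \<in> S" for k using that assms by (auto simp: S_def intro: Nat.gr0I)
  have "(\<Sum>k | k dvd n. moebius_mu k) = (\<Sum>k\<in>S. moebius_mu k)"
    using assms by (intro sum.mono_neutral_right) (auto simp: S_def moebius_mu_def)
  also have "\<dots> = (\<Sum>k\<in>{k\<in>S. \<not> q dvd k}. moebius_mu k) + (\<Sum>k\<in>{k\<in>S. q dvd k}. moebius_mu k)"
    using fin by (subst sum.union_disjoint[symmetric]) (auto intro!: sum.cong)
  also have "{k\<in>S. q dvd k} = (*) q ` {k\<in>S. \<not> q dvd k}"
  proof (intro Set.set_eqI iffI)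
    fix k assume k: "k \<in> {k\<in>S. q dvd k}"
    then obtain j where j: "k = q * j" by blast
    have "\<not> q dvd j"
    proof
      assume "q dvd j"
      then have "q\<^sup>2 dvd k" by (auto simp: j power2_eq_square)
      then show False using k q by (auto simp: S_def squarefree_def)
    qed
    moreover have "j \<in> S" using k calculation squarefree_prime_mult_iff[OF q(1)]
      by (auto simp: S_def j dest: dvd_mult_right)
    ultimately show "k \<in> (*) q ` {k\<in>S. \<not> q dvd k}" using j by auto
  next
    fix k assume "k \<in> (*) q ` {k\<in>S. \<not> q dvd k}"
    then obtain j where j: "k = q * j" "j \<in> S" "\<not> q dvd j" by auto
    have "coprime q j" using q j by (simp add: prime_imp_coprime)
    then have "k dvd n" using q j by (simp add: S_def divides_mult)
    then show "k \<in> {k\<in>S. q dvd k}" using j squarefree_prime_mult_iff[OF q(1) j(3)] by (simp add: S_def)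
  qed
  also have "(\<Sum>k\<in>(*) q ` {k\<in>S. \<not> q dvd k}. moebius_mu k)
      = (\<Sum>k\<in>{k\<in>S. \<not> q dvd k}. - moebius_mu k)"
    using q prime_gt_0_nat pos by (subst sum.reindex) (auto simp: inj_on_def moebius_mu_prime_mult intro!: sum.cong)
  finally show ?thesis using False by (simp add: sum_negf)
qed simp

text \<open>The substitution \<open>k = n div j\<close> turns the multiples of \<open>N\<close>
  among the divisors of \<open>n\<close> into the divisors \<open>j\<close> of
  \<open>n div N\<close>, whose Moebius sum detects \<open>n = N\<close>.\<close>

lemma sum_moebius_mu_multiples:
  assumes "n > 0" "N > 0"
  shows "(\<Sum>k | k dvd n. moebius_mu (n div k) * (if N dvd k then c else 0)) = (if N = n then c else 0)"
proof (cases "N dvd n")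
  case False
  then have "\<not> N dvd k" if "k dvd n" for k using that dvd_trans by blast
  then have "(\<Sum>k | k dvd n. moebius_mu (n div k) * (if N dvd k then c else 0)) = 0"
    by (intro sum.neutral) auto
  then show ?thesis using False by auto
next
  case True
  then obtain r where r: "n = N * r" by blast
  have r0: "r > 0" using r assms by (cases r) auto
  have "(\<Sum>k | k dvd n. moebius_mu (n div k) * (if N dvd k then c else 0))
      = (\<Sum>k | k dvd n \<and> N dvd k. moebius_mu (n div k) * c)"
    using assms by (intro sum.mono_neutral_cong_right) auto
  also have "\<dots> = (\<Sum>j | j dvd r. moebius_mu j * c)"
    using assms r r0 by (intro sum.reindex_bij_witness[of _ "\<lambda>j. n div j" "\<lambda>k. n div k"])
      (auto elim!: dvdE simp: mult.assoc)
  also have "\<dots> = (if r = 1 then c else 0)"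
    using sum_moebius_mu_divisors[OF r0] by (simp flip: sum_distrib_right)
  also have "\<dots> = (if N = n then c else 0)" using r assms by auto
  finally show ?thesis .
qed

text \<open>Moebius exponents are -1, 0 or 1, so a Moebius product is a quotient of two plain
  products. Keeping these apart allows multiplicities to be counted in \<open>int poly\<close>,
  before the quotient is known to be a polynomial.\<close>

definition primitive_num :: "nat \<Rightarrow> nat \<Rightarrow> nat \<Rightarrow> int poly" where
  "primitive_num d m n = (\<Prod>k | k dvd n \<and> moebius_mu (n div k) = 1. orbit_diff d m k)"

definition primitive_den :: "nat \<Rightarrow> nat \<Rightarrow> nat \<Rightarrow> int poly" where
  "primitive_den d m n = (\<Prod>k | k dvd n \<and> moebius_mu (n div k) = - 1. orbit_diff d m k)"

text \<open>The division is exact by \<open>primitive_factor_mult_den\<close>. For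
  \<open>m = 0\<close> this is the Gleason polynomial, whose roots are the parameters at which 0 has
  exact period \<open>n\<close>.\<close>

definition primitive_factor :: "nat \<Rightarrow> nat \<Rightarrow> nat \<Rightarrow> int poly" where
  "primitive_factor d m n = primitive_num d m n div primitive_den d m n"

lemma primitive_num_den_nonzero:
  assumes "d \<ge> 2" "n > 0"
  shows "primitive_num d m n \<noteq> 0" "primitive_den d m n \<noteq> 0"
  using assms dvd_pos_nat[OF assms(2)] by (simp_all add: primitive_num_def primitive_den_def)

text \<open>If \<open>f\<close> has exact period \<open>N\<close> at time \<open>m\<close>, the
  multiplicities \<open>v k\<close> are constant on multiples of \<open>N\<close> and vanish
  elsewhere, so their Moebius sum survives only for \<open>N = n\<close>. If \<open>f\<close>
  divides none of the differences, all terms vanish.\<close>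

lemma multiplicity_primitive_num_den:
  assumes d: "d \<ge> 2" and n: "n > 0" and f: "prime_elem f"
  shows "multiplicity f (primitive_num d m n) = multiplicity f (primitive_den d m n)
    + (if exact_period d f m n then multiplicity f (orbit_diff d m n) else 0)"
proof -
  define v where "v k = multiplicity f (orbit_diff d m k)" for k
  let ?D = "{k. k dvd n}"
  let ?Dp = "{k. k dvd n \<and> moebius_mu (n div k) = 1}"
  let ?Dm = "{k. k dvd n \<and> moebius_mu (n div k) = - 1}"
  have fin: "finite ?D" "finite ?Dp" "finite ?Dm" using n by auto
  have pos: "k > 0" if "k dvd n" for k using that n by (rule dvd_pos_nat[rotated])
  have num: "multiplicity f (primitive_num d m n) = (\<Sum>k\<in>?Dp. v k)"
    unfolding primitive_num_def v_def using fin pos d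
    by (intro prime_elem_multiplicity_prod_distrib[OF f]) force+
  have den: "multiplicity f (primitive_den d m n) = (\<Sum>k\<in>?Dm. v k)"
    unfolding primitive_den_def v_def using fin pos d
    by (intro prime_elem_multiplicity_prod_distrib[OF f]) force+
  have "(\<Sum>k\<in>?D. moebius_mu (n div k) * int (v k))
      = (\<Sum>k\<in>?D. (if moebius_mu (n div k) = 1 then int (v k) else 0)
          - (if moebius_mu (n div k) = - 1 then int (v k) else 0))"
    using moebius_mu_range by (intro sum.cong) auto
  also have "\<dots> = int (\<Sum>k\<in>?Dp. v k) - int (\<Sum>k\<in>?Dm. v k)"
    using fin by (simp add: sum_subtractf sum.If_cases Int_def)
  finally have s: "(\<Sum>k\<in>?D. moebius_mu (n div k) * int (v k))
      = int (\<Sum>k\<in>?Dp. v k) - int (\<Sum>k\<in>?Dm. v k)" .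
  have "(\<Sum>k\<in>?D. moebius_mu (n div k) * int (v k)) = (if exact_period d f m n then int (v n) else 0)"
  proof (cases "\<exists>k>0. f dvd orbit_diff d m k")
    case True
    then obtain N where N: "exact_period d f m N" using exact_period_ex by blast
    have N0: "N > 0" using N by (simp add: exact_period_def)
    have iff: "exact_period d f m n \<longleftrightarrow> N = n"
      using exact_period_dvd_iff[OF N] exact_period_dvd_iff[of d f m n] N
      by (metis dvd_antisym dvd_refl)
    have "(\<Sum>k\<in>?D. moebius_mu (n div k) * int (v k))
        = (\<Sum>k\<in>?D. moebius_mu (n div k) * (if N dvd k then int (v N) else 0))"
      unfolding v_def using multiplicity_orbit_diff[OF d f N] pos by (intro sum.cong) auto
    also have "\<dots> = (if N = n then int (v N) else 0)"
      by (rule sum_moebius_mu_multiples[OF n N0])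
    finally show ?thesis using iff by auto
  next
    case False
    then have "(\<Sum>k\<in>?D. moebius_mu (n div k) * int (v k)) = 0"
      using pos by (intro sum.neutral) (metis (no_types, lifting) mem_Collect_eq mult_zero_right
        not_dvd_imp_multiplicity_0 of_nat_0 v_def)
    moreover have "\<not> exact_period d f m n" using False by (auto simp: exact_period_def)
    ultimately show ?thesis by simp
  qed
  then have "int (\<Sum>k\<in>?Dp. v k) = int ((\<Sum>k\<in>?Dm. v k) + (if exact_period d f m n then v n else 0))"
    unfolding s by (auto split: if_splits)
  then show ?thesis unfolding num den of_nat_eq_iff by (simp add: v_def)
qed

text \<open>Unique factorization in \<open>int poly\<close> reduces the divisibility to a comparison
  of multiplicities at each prime.\<close>

lemma primitive_factor_mult_den:
  assumes "d \<ge> 2" "n > 0"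
  shows "primitive_factor d m n * primitive_den d m n = primitive_num d m n"
proof -
  have "primitive_den d m n dvd primitive_num d m n"
    using assms by (intro multiplicity_le_imp_dvd)
      (auto simp: multiplicity_primitive_num_den prime_imp_prime_elem primitive_num_den_nonzero)
  then show ?thesis by (simp add: primitive_factor_def)
qed

lemma primitive_factor_nonzero:
  assumes "d \<ge> 2" "n > 0"
  shows "primitive_factor d m n \<noteq> 0"
  using primitive_factor_mult_den[OF assms, of m] primitive_num_den_nonzero[OF assms, of m] by auto

lemma multiplicity_primitive_factor:
  assumes "d \<ge> 2" "n > 0" "prime_elem f"
  shows "multiplicity f (primitive_factor d m n)
    = (if exact_period d f m n then multiplicity f (orbit_diff d m n) else 0)"
proof -
  have "multiplicity f (primitive_num d m n)
      = multiplicity f (primitive_factor d m n) + multiplicity f (primitive_den d m n)"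
    using primitive_factor_mult_den[OF assms(1,2), of m, symmetric] assms
    by (simp add: prime_elem_multiplicity_mult_distrib primitive_factor_nonzero primitive_num_den_nonzero)
  then show ?thesis using multiplicity_primitive_num_den[OF assms, of m] by simp
qed

lemma primitive_factor_dvd:
  assumes "d \<ge> 2" "n > 0"
  shows "primitive_factor d m n dvd orbit_diff d m n"
  using assms by (intro multiplicity_le_imp_dvd)
    (auto simp: multiplicity_primitive_factor prime_imp_prime_elem primitive_factor_nonzero)

lemma to_fract_prod: "to_fract (prod f A) = (\<Prod>x\<in>A. to_fract (f x))"
  by (cases "finite A", induction A rule: finite_induct) simp_all

lemma to_fract_power: "to_fract (x ^ n) = to_fract x ^ n"
  by (induction n) simp_all

lemma prod_to_fract_powi_moebius:
  assumes "d \<ge> 2" "n > 0"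
  shows "(\<Prod>k | k dvd n. to_fract (orbit_diff d m k) powi moebius_mu (n div k))
    = to_fract (primitive_factor d m n)"
proof -
  let ?g = "\<lambda>k. to_fract (orbit_diff d m k)"
  have "(\<Prod>k | k dvd n. ?g k powi moebius_mu (n div k))
      = (\<Prod>k | k dvd n. (if moebius_mu (n div k) = 1 then ?g k else 1)
          / (if moebius_mu (n div k) = - 1 then ?g k else 1))"
  proof (intro prod.cong refl)
    fix k
    show "?g k powi moebius_mu (n div k) = (if moebius_mu (n div k) = 1 then ?g k else 1)
          / (if moebius_mu (n div k) = - 1 then ?g k else 1)"
    proof -
      consider "moebius_mu (n div k) = - 1" | "moebius_mu (n div k) = 0" | "moebius_mu (n div k) = 1"
        using moebius_mu_range[of "n div k"] by blast
      then show ?thesis by cases (simp_all add: power_int_minus inverse_eq_divide del: to_fract_diff)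
    qed
  qed
  also have "\<dots> = to_fract (primitive_num d m n) / to_fract (primitive_den d m n)"
    unfolding prod_dividef primitive_num_def primitive_den_def to_fract_prod
    using assms by (subst (1 2) prod.If_cases) (simp_all add: Int_def)
  also have "\<dots> = to_fract (primitive_factor d m n)"
    unfolding primitive_factor_mult_den[OF assms, symmetric]
    using primitive_num_den_nonzero[OF assms] by simp
  finally show ?thesis .
qed

lemma F_fract_eq:
  assumes "d \<ge> 2" "n > 0"
  shows "F_fract d m n = to_fract (primitive_factor d m n) / to_fract (primitive_factor d (m - 1) n)"
proof -
  have "F_fract d m n = (\<Prod>k | k dvd n. to_fract (orbit_diff d m k) powi moebius_mu (n div k)
      / to_fract (orbit_diff d (m - 1) k) powi moebius_mu (n div k))"
    unfolding F_fract_def orbit_diff_def power_int_divide_distrib ..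
  then show ?thesis
    unfolding prod_dividef prod_to_fract_powi_moebius[OF assms] .
qed

text \<open>The orbit point at time 1 is the parameter itself, so subtracting it from the point at
  time \<open>k + 1\<close> leaves exactly a \<open>d\<close>-th power. Moebius products commute
  with powers.\<close>

lemma primitive_factor_1:
  assumes "d \<ge> 2" "n > 0"
  shows "primitive_factor d 1 n = primitive_factor d 0 n ^ d"
proof -
  have 1: "orbit_diff d 1 k = crit_orbit d k ^ d" for k
    using assms(1) crit_orbit_Suc[of d k] crit_orbit_Suc[of d 0] by (simp add: orbit_diff_def power_0_left)
  have "to_fract (primitive_factor d 1 n) = to_fract (primitive_factor d 0 n ^ d)"
  proof -
    have "to_fract (orbit_diff d 1 k) powi j = (to_fract (orbit_diff d 0 k) powi j) ^ d" for k j
      unfolding 1 orbit_diff_0 to_fract_power power_int_power power_int_power' by (simp only: mult.commute)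
    then show ?thesis
      unfolding to_fract_power prod_to_fract_powi_moebius[OF assms, symmetric] prod_power_distrib by (simp only:)
  qed
  then show ?thesis by simp
qed

lemma F_fract_1:
  assumes "d \<ge> 2" "n > 0"
  shows "F_fract d 1 n = to_fract (primitive_factor d 0 n ^ (d - 1))"
proof -
  have "primitive_factor d 0 n ^ d = primitive_factor d 0 n ^ (d - 1) * primitive_factor d 0 n"
    using assms by (cases d) auto
  then show ?thesis
    using F_fract_eq[OF assms, of 1] primitive_factor_1[OF assms] primitive_factor_nonzero[OF assms]
    by simp
qed

section \<open>Polynomiality of the quotients defining \<open>G_poly\<close>\<close>

lemma crit_orbit_dvd_multiple: "crit_orbit d n dvd crit_orbit d (j * n)"
  using dvd_orbit_diff_mod_iff[of "crit_orbit d n" d 0 n "j * n"] by simp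

text \<open>This is \<open>(x ^ d - y ^ d) / (x - y)\<close> at the orbit points \<open>x\<close> of
  time \<open>m + n\<close> and \<open>y\<close> of time \<open>m\<close>, written without
  division.\<close>

definition diff_quotient :: "nat \<Rightarrow> nat \<Rightarrow> nat \<Rightarrow> int poly" where
  "diff_quotient d m n = (\<Sum>i<d. crit_orbit d m ^ (d - Suc i) * crit_orbit d (m + n) ^ i)"

lemma orbit_diff_Suc: "orbit_diff d (Suc m) n = orbit_diff d m n * diff_quotient d m n"
  unfolding orbit_diff_def diff_quotient_def
  by (simp add: crit_orbit_Suc power_diff_sumr2)

text \<open>Both points are multiples of the one at time \<open>n\<close>, and each summand is a
  product of \<open>d - 1\<close> of them.\<close>

lemma crit_orbit_power_dvd_diff_quotient:
  assumes "n dvd m"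
  shows "crit_orbit d n ^ (d - 1) dvd diff_quotient d m n"
proof -
  obtain j where j: "m = j * n" using assms by (metis dvdE mult.commute)
  have dvd: "crit_orbit d n dvd crit_orbit d (m + n)" "crit_orbit d n dvd crit_orbit d m"
    using crit_orbit_dvd_multiple[of d n j] crit_orbit_dvd_multiple[of d n "Suc j"]
    by (simp_all add: j add.commute)
  show ?thesis unfolding diff_quotient_def
  proof (rule dvd_sum)
    fix i assume "i \<in> {..<d}"
    then have "d - 1 = (d - Suc i) + i" by simp
    then show "crit_orbit d n ^ (d - 1) dvd crit_orbit d m ^ (d - Suc i) * crit_orbit d (m + n) ^ i"
      using dvd by (metis dvd_power_same mult_dvd_mono power_add)
  qed
qed

text \<open>A prime of exact period \<open>n\<close> at time \<open>m\<close> keeps it at time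
  \<open>m + 1\<close>, and its multiplicity grows by that of \<open>diff_quotient\<close>, which
  absorbs the extra power when \<open>n\<close> divides \<open>m\<close>. A prime without that
  period at time \<open>m\<close> lacks it at time 0 as well, so it does not occur on the
  left.\<close>

lemma primitive_factor_dvd_Suc:
  assumes d: "d \<ge> 2" and n: "n > 0"
  shows "primitive_factor d m n * (if n dvd m then primitive_factor d 0 n ^ (d - 1) else 1)
    dvd primitive_factor d (Suc m) n"
proof (rule multiplicity_le_imp_dvd)
  show "primitive_factor d m n * (if n dvd m then primitive_factor d 0 n ^ (d - 1) else 1) \<noteq> 0"
    using primitive_factor_nonzero[OF d n] by simp
  fix f :: "int poly" assume "prime f"
  then have f: "prime_elem f" by simp
  have nz: "diff_quotient d m n \<noteq> 0"
    using orbit_diff_Suc[of d m n] orbit_diff_nonzero[OF d n, of "Suc m"] by auto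
  have suc: "multiplicity f (orbit_diff d (Suc m) n)
      = multiplicity f (orbit_diff d m n) + multiplicity f (diff_quotient d m n)"
    unfolding orbit_diff_Suc using d n nz f by (simp add: prime_elem_multiplicity_mult_distrib)
  have lhs: "multiplicity f (primitive_factor d m n * (if n dvd m then primitive_factor d 0 n ^ (d - 1) else 1))
     = multiplicity f (primitive_factor d m n)
       + (if n dvd m then (d - 1) * multiplicity f (primitive_factor d 0 n) else 0)"
    using primitive_factor_nonzero[OF d n] f
    by (simp add: prime_elem_multiplicity_mult_distrib prime_elem_multiplicity_power_distrib)
  show "multiplicity f (primitive_factor d m n * (if n dvd m then primitive_factor d 0 n ^ (d - 1) else 1))
    \<le> multiplicity f (primitive_factor d (Suc m) n)"
  proof (cases "exact_period d f m n")
    case True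
    have "exact_period d f (Suc m) n" using exact_period_mono[OF True] by simp
    moreover have "(d - 1) * multiplicity f (crit_orbit d n) \<le> multiplicity f (diff_quotient d m n)"
      if "n dvd m"
      using dvd_imp_multiplicity_le[OF crit_orbit_power_dvd_diff_quotient[OF that] nz, of f]
        orbit_diff_nonzero[OF d n, of 0] f
      by (simp add: prime_elem_multiplicity_power_distrib)
    ultimately show ?thesis using True
      unfolding lhs by (auto simp: multiplicity_primitive_factor[OF d n f] suc)
  next
    case False
    then have "\<not> exact_period d f 0 n" using exact_period_mono[of d f 0 n m] by auto
    with False show ?thesis unfolding lhs by (simp add: multiplicity_primitive_factor[OF d n f])
  qed
qed

text \<open>By \<open>primitive_factor_dvd_Suc\<close> at \<open>m - 1\<close> the denominator of
  \<open>G_fract\<close> divides its numerator. This gives the description in \<open>G_poly\<close>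
  a witness, unique since \<open>to_fract\<close> is injective.\<close>

lemma G_poly_mult:
  assumes d: "d \<ge> 2" and n: "n > 0" and m: "m > 0"
  shows "G_poly d m n * (primitive_factor d (m - 1) n
      * (if n dvd m - 1 then primitive_factor d 0 n ^ (d - 1) else 1)) = primitive_factor d m n"
proof -
  define D where "D = primitive_factor d (m - 1) n
      * (if n dvd m - 1 then primitive_factor d 0 n ^ (d - 1) else 1)"
  have D0: "D \<noteq> 0" using primitive_factor_nonzero[OF d n] by (simp add: D_def)
  obtain H where H: "primitive_factor d m n = D * H"
    using primitive_factor_dvd_Suc[OF d n, of "m - 1"] m unfolding D_def by (auto elim!: dvdE)
  have G: "G_fract d m n = to_fract (primitive_factor d m n) / to_fract D"
    unfolding G_fract_def F_fract_1[OF d n] unfolding F_fract_eq[OF d n] D_def by simp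
  then have "to_fract H = G_fract d m n" unfolding G H using D0 by simp
  then have "to_fract (G_poly d m n) = G_fract d m n"
    unfolding G_poly_def by (metis (mono_tags, lifting) theI to_fract_eq_iff)
  then have "G_poly d m n = H" using \<open>to_fract H = G_fract d m n\<close> by (metis to_fract_eq_iff)
  then show ?thesis using H by (simp add: D_def mult.commute)
qed

section \<open>Congruences modulo the prime\<close>

text \<open>Membership unfolds to an explicit linear combination, which can later be evaluated at an
  algebraic number.\<close>

definition ideal2 :: "'a::comm_ring_1 \<Rightarrow> 'a \<Rightarrow> 'a set" where
  "ideal2 a b = {a * u + b * v | u v. True}"

lemma ideal2_add: "x \<in> ideal2 a b \<Longrightarrow> y \<in> ideal2 a b \<Longrightarrow> x + y \<in> ideal2 a b"
  unfolding ideal2_def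
proof clarify
  fix u v u' v'
  show "\<exists>u'' v''. a * u + b * v + (a * u' + b * v') = a * u'' + b * v'' \<and> True"
    by (rule exI[of _ "u + u'"], rule exI[of _ "v + v'"]) (simp add: algebra_simps)
qed

lemma ideal2_mult: "x \<in> ideal2 a b \<Longrightarrow> x * y \<in> ideal2 a b"
  unfolding ideal2_def
proof clarify
  fix u v
  show "\<exists>u'' v''. (a * u + b * v) * y = a * u'' + b * v'' \<and> True"
    by (rule exI[of _ "u * y"], rule exI[of _ "v * y"]) (simp add: algebra_simps)
qed

lemma ideal2_mult_left: "x \<in> ideal2 a b \<Longrightarrow> y * x \<in> ideal2 a b"
  using ideal2_mult[of x a b y] by (simp add: mult.commute)

lemma ideal2_diff: "x \<in> ideal2 a b \<Longrightarrow> y \<in> ideal2 a b \<Longrightarrow> x - y \<in> ideal2 a b"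
  using ideal2_add[of x a b "y * (- 1)"] ideal2_mult[of y a b "- 1"] by simp

lemma ideal2_dvd1: "a dvd x \<Longrightarrow> x \<in> ideal2 a b"
  unfolding ideal2_def by (elim dvdE) (force intro: exI[of _ 0])

lemma ideal2_dvd2: "b dvd x \<Longrightarrow> x \<in> ideal2 a b"
  unfolding ideal2_def by (elim dvdE) (force intro: exI[of _ 0])

definition unit_mod :: "'a::comm_ring_1 set \<Rightarrow> 'a \<Rightarrow> bool" where
  "unit_mod I x \<longleftrightarrow> (\<exists>s. x * s - 1 \<in> I)"

lemma unit_mod_mult:
  assumes "unit_mod (ideal2 a b) x" "unit_mod (ideal2 a b) y"
  shows "unit_mod (ideal2 a b) (x * y)"
proof -
  obtain s t where st: "x * s - 1 \<in> ideal2 a b" "y * t - 1 \<in> ideal2 a b"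
    using assms unfolding unit_mod_def by blast
  have "(x * s - 1) * (y * t) + (y * t - 1) \<in> ideal2 a b"
    using st by (intro ideal2_add ideal2_mult)
  then have "(x * y) * (s * t) - 1 \<in> ideal2 a b" by (simp add: algebra_simps)
  then show ?thesis unfolding unit_mod_def by blast
qed

lemma unit_mod_power:
  assumes "unit_mod (ideal2 a b) x"
  shows "unit_mod (ideal2 a b) (x ^ n)"
proof (induction n)
  case 0
  have "1 * 1 - 1 \<in> ideal2 a b" using ideal2_dvd1[of a 0 b] by simp
  then show ?case unfolding unit_mod_def power_0 by blast
qed (use assms unit_mod_mult in auto)

lemma unit_mod_cong:
  assumes "unit_mod (ideal2 a b) x" "y - x \<in> ideal2 a b"
  shows "unit_mod (ideal2 a b) y"
proof -
  obtain s where s: "x * s - 1 \<in> ideal2 a b" using assms unfolding unit_mod_def by blast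
  have "(y - x) * s + (x * s - 1) \<in> ideal2 a b" by (intro ideal2_add ideal2_mult s assms)
  then show ?thesis unfolding unit_mod_def by (auto simp: algebra_simps)
qed

lemma unit_mod_dvd:
  assumes "unit_mod I x" "y dvd x"
  shows "unit_mod I y"
  using assms unfolding unit_mod_def by (metis dvdE mult.assoc)

section \<open>Frobenius congruences for the orbit and its primitive parts\<close>

lemma dvd_prod_diff:
  fixes f g :: "'b \<Rightarrow> 'a::comm_ring_1"
  assumes "\<And>x. x \<in> A \<Longrightarrow> c dvd f x - g x"
  shows "c dvd prod f A - prod g A"
  using assms
proof (induction A rule: infinite_finite_induct)
  case (insert x A)
  have "prod f (insert x A) - prod g (insert x A) = f x * (prod f A - prod g A) + (f x - g x) * prod g A"
    using insert.hyps by (simp add: algebra_simps)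
  then show ?case using insert by (metis dvd_add dvd_mult dvd_mult2 insertCI)
qed auto

lemma dvd_diff_trans:
  fixes a b c p :: "'a::comm_ring_1"
  shows "p dvd a - b \<Longrightarrow> p dvd b - c \<Longrightarrow> p dvd a - c"
  using dvd_add[of p "a - b" "b - c"] by simp

lemma prime_dvd_power_add_diff:
  fixes x y :: "'a::comm_ring_1"
  assumes "prime p"
  shows "of_nat p dvd (x + y) ^ p - (x ^ p + y ^ p)"
proof -
  have p0: "p > 0" using assms prime_gt_0_nat by blast
  have "(x + y) ^ p = (\<Sum>k\<le>p. of_nat (p choose k) * x ^ k * y ^ (p - k))" by (rule binomial_ring)
  also have "{..p} = insert 0 (insert p {1..<p})" using p0 by auto
  also have "(\<Sum>k\<in>\<dots>. of_nat (p choose k) * x ^ k * y ^ (p - k))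
      = y ^ p + x ^ p + (\<Sum>k=1..<p. of_nat (p choose k) * x ^ k * y ^ (p - k))"
    using p0 by simp
  finally have eq: "(x + y) ^ p - (x ^ p + y ^ p)
      = (\<Sum>k=1..<p. of_nat (p choose k) * x ^ k * y ^ (p - k))" by simp
  show ?thesis unfolding eq
  proof (rule dvd_sum)
    fix k assume "k \<in> {1..<p}"
    then have "p dvd p choose k" using assms by (intro dvd_choose_prime) auto
    then have "(of_nat p :: 'a) dvd of_nat (p choose k)" by (auto elim!: dvdE)
    then show "(of_nat p :: 'a) dvd of_nat (p choose k) * x ^ k * y ^ (p - k)"
      by (simp add: mult.assoc)
  qed
qed

lemma prime_dvd_diff_power:
  fixes x y :: "'a::comm_ring_1"
  assumes "prime p"
  shows "of_nat p dvd (x ^ p - y ^ p) - (x - y) ^ p"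
  using prime_dvd_power_add_diff[OF assms, of "x - y" y] by (simp add: algebra_simps)

text \<open>Each further step of the map cancels the parameter in the difference and, by Frobenius,
  raises the difference to the \<open>p\<close>-th power modulo \<open>p\<close>.\<close>

lemma orbit_diff_mod_prime:
  assumes "prime p"
  shows "of_nat p dvd orbit_diff p m k - crit_orbit p k ^ (p ^ m)"
proof (induction m)
  case (Suc m)
  have "of_nat p dvd orbit_diff p (Suc m) k - orbit_diff p m k ^ p"
    using prime_dvd_diff_power[OF assms, of "crit_orbit p (m + k)" "crit_orbit p m"]
    by (simp add: orbit_diff_def crit_orbit_Suc)
  moreover have "of_nat p dvd orbit_diff p m k ^ p - (crit_orbit p k ^ (p ^ m)) ^ p"
    using Suc power_diff_dvd dvd_trans by blast
  ultimately have "of_nat p dvd orbit_diff p (Suc m) k - (crit_orbit p k ^ (p ^ m)) ^ p"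
    by (rule dvd_diff_trans)
  then show ?case by (simp add: power_mult[symmetric] mult.commute)
qed simp

lemma prime_elem_dvd_prod:
  assumes "prime_elem q" "q dvd prod f A"
  shows "\<exists>x\<in>A. q dvd f x"
  using assms(2)
  by (induction A rule: infinite_finite_induct)
    (use assms(1) in \<open>auto simp: prime_elem_dvd_mult_iff prime_elem_not_unit\<close>)

lemma prime_elem_of_nat_poly:
  assumes "prime p"
  shows "prime_elem (of_nat p :: int poly)"
  using assms by (simp add: of_nat_poly lift_prime_elem_poly)

text \<open>The differences are monic, so \<open>p\<close> cannot divide them. This is what permits
  cancelling their factors in congruences modulo \<open>p\<close>.\<close>

lemma of_nat_not_dvd_divisor_orbit_diff:
  assumes "prime p" "k > 0" "f dvd orbit_diff p m k"
  shows "\<not> (of_nat p :: int poly) dvd f"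
proof
  assume "(of_nat p :: int poly) dvd f"
  then have "[:int p:] dvd orbit_diff p m k" using assms dvd_trans by (metis of_nat_poly)
  then have "int p dvd lead_coeff (orbit_diff p m k)" by (simp add: const_poly_dvd_iff)
  then show False
    using assms(1) orbit_diff_monic(2)[OF prime_ge_2_nat[OF assms(1)] assms(2), of m] by simp
qed

text \<open>The congruence holds factor by factor for numerator and denominator. As \<open>p\<close>
  stays prime in \<open>int poly\<close> and does not divide the denominator, it passes to the
  quotient.\<close>

lemma primitive_factor_mod_prime:
  assumes p: "prime p" and n: "n > 0"
  shows "of_nat p dvd primitive_factor p m n - primitive_factor p 0 n ^ (p ^ m)"
proof -
  note p2 = prime_ge_2_nat[OF p]
  have num: "of_nat p dvd primitive_num p m n - primitive_num p 0 n ^ (p ^ m)"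
    unfolding primitive_num_def prod_power_distrib orbit_diff_0
    by (rule dvd_prod_diff) (rule orbit_diff_mod_prime[OF p])
  have den: "of_nat p dvd primitive_den p m n - primitive_den p 0 n ^ (p ^ m)"
    unfolding primitive_den_def prod_power_distrib orbit_diff_0
    by (rule dvd_prod_diff) (rule orbit_diff_mod_prime[OF p])
  have "\<not> (of_nat p :: int poly) dvd primitive_den p m n"
  proof
    assume *: "(of_nat p :: int poly) dvd primitive_den p m n"
    have "\<exists>k\<in>{k. k dvd n \<and> moebius_mu (n div k) = - 1}. (of_nat p :: int poly) dvd orbit_diff p m k"
      using * unfolding primitive_den_def by (rule prime_elem_dvd_prod[OF prime_elem_of_nat_poly[OF p]])
    then show False using of_nat_not_dvd_divisor_orbit_diff[OF p _ dvd_refl] n dvd_pos_nat by blast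
  qed
  moreover have "of_nat p dvd primitive_den p m n
      * (primitive_factor p m n - primitive_factor p 0 n ^ (p ^ m))"
  proof -
    have "primitive_den p m n * (primitive_factor p m n - primitive_factor p 0 n ^ (p ^ m))
      = (primitive_num p m n - primitive_num p 0 n ^ (p ^ m))
        - (primitive_den p m n - primitive_den p 0 n ^ (p ^ m)) * primitive_factor p 0 n ^ (p ^ m)"
      unfolding primitive_factor_mult_den[OF p2 n, symmetric] by (simp add: algebra_simps power_mult_distrib)
    then show ?thesis using num den by (metis dvd_diff dvd_mult2)
  qed
  ultimately show ?thesis
    using prime_elem_dvd_mult_iff[OF prime_elem_of_nat_poly[OF p]] by blast
qed

definition primitive_cofactor :: "nat \<Rightarrow> nat \<Rightarrow> nat \<Rightarrow> int poly" where
  "primitive_cofactor d m n = orbit_diff d m n div primitive_factor d m n"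

lemma orbit_diff_factor:
  assumes "d \<ge> 2" "n > 0"
  shows "orbit_diff d m n = primitive_factor d m n * primitive_cofactor d m n"
  using primitive_factor_dvd[OF assms] by (simp add: primitive_cofactor_def)

lemma primitive_cofactor_mod_prime:
  assumes p: "prime p" and n: "n > 0"
  shows "of_nat p dvd primitive_cofactor p m n - primitive_cofactor p 0 n ^ (p ^ m)"
proof -
  note p2 = prime_ge_2_nat[OF p]
  have "primitive_factor p m n * (primitive_cofactor p m n - primitive_cofactor p 0 n ^ (p ^ m))
    = (orbit_diff p m n - orbit_diff p 0 n ^ (p ^ m))
      - (primitive_factor p m n - primitive_factor p 0 n ^ (p ^ m)) * primitive_cofactor p 0 n ^ (p ^ m)"
    unfolding orbit_diff_factor[OF p2 n] by (simp add: algebra_simps power_mult_distrib)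
  then have "of_nat p dvd primitive_factor p m n * (primitive_cofactor p m n - primitive_cofactor p 0 n ^ (p ^ m))"
    using orbit_diff_mod_prime[OF p, of m n] primitive_factor_mod_prime[OF p n, of m]
    by (metis dvd_diff dvd_mult2 orbit_diff_0)
  then show ?thesis
    using prime_elem_dvd_mult_iff[OF prime_elem_of_nat_poly[OF p]]
      of_nat_not_dvd_divisor_orbit_diff[OF p n primitive_factor_dvd[OF p2 n]] by blast
qed

section \<open>Derivatives in the parameter, and units modulo \<open>p\<close> and the Gleason
  polynomial \<open>A\<close>\<close>

lemma pderiv_crit_orbit:
  "\<exists>u. pderiv (crit_orbit d (Suc k)) = 1 + of_nat d * u"
proof -
  have "pderiv (crit_orbit d k ^ d) = of_nat d * (crit_orbit d k ^ (d - 1) * pderiv (crit_orbit d k))"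
    by (cases d) (simp_all add: pderiv_power_Suc of_nat_poly del: of_nat_Suc power_Suc)
  moreover have "pderiv [:0, 1 :: int:] = 1" by (simp add: pderiv_pCons one_pCons)
  ultimately have "pderiv (crit_orbit d (Suc k))
      = 1 + of_nat d * (crit_orbit d k ^ (d - 1) * pderiv (crit_orbit d k))"
    unfolding crit_orbit_Suc pderiv_add by simp
  then show ?thesis by blast
qed

text \<open>Differentiating the factorization \<open>?A * ?C\<close> of the orbit point, whose
  derivative is 1 modulo \<open>p\<close>, exhibits \<open>pderiv ?A\<close> as an inverse of
  \<open>?C\<close> modulo \<open>p\<close> and \<open>?A\<close>.\<close>

lemma primitive_cofactor_unit:
  assumes p: "prime p" and n: "n > 0"
  shows "unit_mod (ideal2 (of_nat p) (primitive_factor p 0 n)) (primitive_cofactor p 0 n)"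
proof -
  let ?A = "primitive_factor p 0 n" and ?C = "primitive_cofactor p 0 n"
  obtain k where k: "n = Suc k" using n by (cases n) auto
  obtain u where u: "pderiv (crit_orbit p n) = 1 + of_nat p * u" using pderiv_crit_orbit k by blast
  have "crit_orbit p n = ?A * ?C"
    using orbit_diff_factor[OF prime_ge_2_nat[OF p] n, of 0] by simp
  then have "1 + of_nat p * u = ?A * pderiv ?C + ?C * pderiv ?A"
    using u by (simp add: pderiv_mult)
  then have "?C * pderiv ?A - 1 = of_nat p * u + ?A * (- pderiv ?C)" by (simp add: algebra_simps)
  then show ?thesis unfolding unit_mod_def ideal2_def by blast
qed

text \<open>A prime factor of the primitive factor has exact period \<open>n\<close>, so it does not
  divide the point at the smaller time \<open>g\<close>. Both factors therefore divide the point at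
  time \<open>n\<close> independently.\<close>

lemma crit_orbit_dvd_cofactor:
  assumes d: "d \<ge> 2" and n: "n > 0" and g: "g dvd n" "g < n"
  shows "crit_orbit d g dvd primitive_cofactor d 0 n"
proof -
  have g0: "g > 0" using g(1) n by (rule dvd_pos_nat[rotated])
  note nz = orbit_diff_nonzero[OF d g0, of 0] orbit_diff_nonzero[OF d n, of 0]
  have "primitive_factor d 0 n * crit_orbit d g dvd crit_orbit d n"
  proof (rule multiplicity_le_imp_dvd)
    show "primitive_factor d 0 n * crit_orbit d g \<noteq> 0"
      using primitive_factor_nonzero[OF d n] nz by simp
    fix f :: "int poly" assume "prime f"
    then have f: "prime_elem f" by simp
    obtain j where j: "n = j * g" using g by (metis dvdE mult.commute)
    have "multiplicity f (crit_orbit d g) \<le> multiplicity f (crit_orbit d n)"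
      using nz crit_orbit_dvd_multiple[of d g j] unfolding j by (intro dvd_imp_multiplicity_le) auto
    moreover have "multiplicity f (crit_orbit d g) = 0" if "exact_period d f 0 n"
      using exact_period_dvd_iff[OF that, of g] g g0 by (auto simp: not_dvd_imp_multiplicity_0 dest: dvd_imp_le)
    ultimately show "multiplicity f (primitive_factor d 0 n * crit_orbit d g) \<le> multiplicity f (crit_orbit d n)"
      using nz primitive_factor_nonzero[OF d n] f
      by (auto simp: prime_elem_multiplicity_mult_distrib multiplicity_primitive_factor[OF d n f])
  qed
  then show ?thesis
    using orbit_diff_factor[OF d n, of 0] primitive_factor_nonzero[OF d n] by simp
qed

text \<open>With the Bezout relation \<open>r * x = n * y + gcd r n\<close>, the points at times
  \<open>r * x\<close> and \<open>gcd r n\<close> agree modulo the point at time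
  \<open>n\<close>.\<close>

lemma crit_orbit_gcd_in_ideal:
  assumes "r > 0"
  shows "crit_orbit d (gcd r n) \<in> ideal2 (crit_orbit d r) (crit_orbit d n)"
proof -
  obtain x y where xy: "r * x = n * y + gcd r n" using bezout_nat assms by blast
  have "crit_orbit d (n * y) dvd crit_orbit d (gcd r n + n * y) - crit_orbit d (gcd r n)"
    using orbit_diff_dvd_shift[of d 0 "n * y" "gcd r n"] by simp
  then have "crit_orbit d n dvd crit_orbit d (r * x) - crit_orbit d (gcd r n)"
    using xy crit_orbit_dvd_multiple[of d n y] dvd_trans by (metis add.commute mult.commute)
  moreover have "crit_orbit d r dvd crit_orbit d (r * x)"
    using crit_orbit_dvd_multiple[of d r x] by (simp add: mult.commute)
  ultimately have "crit_orbit d (r * x) - (crit_orbit d (r * x) - crit_orbit d (gcd r n))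
      \<in> ideal2 (crit_orbit d r) (crit_orbit d n)"
    by (intro ideal2_diff ideal2_dvd1[of "crit_orbit d r"] ideal2_dvd2[of "crit_orbit d n"])
  then show ?thesis by simp
qed

text \<open>The point at time \<open>gcd r n\<close>, with \<open>gcd r n < n\<close>, divides the
  unit \<open>primitive_cofactor p 0 n\<close>. It is a multiple of the point at time
  \<open>r\<close> modulo the point at time \<open>n\<close>, which is itself a multiple of
  \<open>primitive_factor p 0 n\<close>.\<close>

lemma crit_orbit_unit:
  assumes p: "prime p" and n: "n > 0" and r: "\<not> n dvd r"
  shows "unit_mod (ideal2 (of_nat p) (primitive_factor p 0 n)) (crit_orbit p r)"
proof -
  let ?I = "ideal2 (of_nat p) (primitive_factor p 0 n)"
  note p2 = prime_ge_2_nat[OF p]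
  have "r > 0" using r by (cases r) auto
  then obtain s t where st: "crit_orbit p (gcd r n) = crit_orbit p r * s + crit_orbit p n * t"
    using crit_orbit_gcd_in_ideal unfolding ideal2_def by blast
  have "gcd r n \<noteq> n" using r by (metis gcd_dvd1)
  then have "gcd r n < n" using n by (simp add: gcd_le2_nat le_neq_implies_less)
  then have "unit_mod ?I (crit_orbit p (gcd r n))"
    using unit_mod_dvd[OF primitive_cofactor_unit[OF p n]] crit_orbit_dvd_cofactor[OF p2 n] by simp
  moreover have "primitive_factor p 0 n dvd crit_orbit p n"
    using primitive_factor_dvd[OF p2 n, of 0] by simp
  then have "crit_orbit p r * s - crit_orbit p (gcd r n) \<in> ?I"
    unfolding st by (intro ideal2_dvd2) auto
  ultimately have "unit_mod ?I (crit_orbit p r * s)" by (rule unit_mod_cong)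
  then show ?thesis by (rule unit_mod_dvd) simp
qed

text \<open>Modulo \<open>p\<close>, the sequences \<open>a_n ^ p - a_n\<close> and
  \<open>c ^ (p ^ n) - c\<close> satisfy the same recursion: the next term is the
  \<open>p\<close>-th power of the present one plus \<open>c ^ p - c\<close>. Both start at
  0.\<close>

lemma crit_orbit_power_minus_self:
  assumes "prime p"
  shows "of_nat p dvd (crit_orbit p n ^ p - crit_orbit p n) - ([:0, 1:] ^ (p ^ n) - [:0, 1:])"
proof (induction n)
  case 0
  then show ?case using prime_gt_0_nat[OF assms] by (simp add: power_0_left)
next
  case (Suc n)
  let ?X = "[:0, 1:] :: int poly" and ?a = "crit_orbit p n"
  have 1: "of_nat p dvd (?a ^ p + ?X) ^ p - ((?a ^ p) ^ p + ?X ^ p)"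
    by (rule prime_dvd_power_add_diff[OF assms])
  have 2: "of_nat p dvd ((?a ^ p) ^ p - ?a ^ p) - (?a ^ p - ?a) ^ p"
    by (rule prime_dvd_diff_power[OF assms])
  have 3: "of_nat p dvd (?a ^ p - ?a) ^ p - (?X ^ (p ^ n) - ?X) ^ p"
    using Suc power_diff_dvd dvd_trans by blast
  have 4: "of_nat p dvd ((?X ^ (p ^ n)) ^ p - ?X ^ p) - (?X ^ (p ^ n) - ?X) ^ p"
    by (rule prime_dvd_diff_power[OF assms])
  have "(crit_orbit p (Suc n) ^ p - crit_orbit p (Suc n)) - (?X ^ (p ^ Suc n) - ?X)
    = ((?a ^ p + ?X) ^ p - ((?a ^ p) ^ p + ?X ^ p)) + (((?a ^ p) ^ p - ?a ^ p) - (?a ^ p - ?a) ^ p)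
      + ((?a ^ p - ?a) ^ p - (?X ^ (p ^ n) - ?X) ^ p) - (((?X ^ (p ^ n)) ^ p - ?X ^ p) - (?X ^ (p ^ n) - ?X) ^ p)"
    by (simp add: crit_orbit_Suc power_mult[symmetric] mult.commute)
  then show ?case using 1 2 3 4 by (metis dvd_add dvd_diff)
qed

lemma X_power_minus_X_in_ideal:
  assumes p: "prime p" and n: "n > 0"
  shows "[:0, 1:] ^ (p ^ n) - [:0, 1:] \<in> ideal2 (of_nat p) (primitive_factor p 0 n)"
proof -
  let ?I = "ideal2 (of_nat p) (primitive_factor p 0 n)"
  have "primitive_factor p 0 n dvd crit_orbit p n"
    using primitive_factor_dvd[OF prime_ge_2_nat[OF p] n, of 0] by simp
  moreover have "p > 0" using p prime_gt_0_nat by blast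
  ultimately have "crit_orbit p n ^ p - crit_orbit p n \<in> ?I"
    by (intro ideal2_diff ideal2_dvd2) (auto intro: dvd_power_same dvd_trans dvd_power)
  then have "(crit_orbit p n ^ p - crit_orbit p n)
      - ((crit_orbit p n ^ p - crit_orbit p n) - ([:0, 1:] ^ (p ^ n) - [:0, 1:])) \<in> ?I"
    using ideal2_dvd1[OF crit_orbit_power_minus_self[OF p, of n]] by (rule ideal2_diff)
  moreover have "a - (a - b) = b" for a b :: "int poly" by simp
  ultimately show ?thesis by metis
qed

section \<open>Expansions of the difference quotient\<close>

lemma crit_orbit_power_dvd_shift:
  assumes "k > 0"
  shows "crit_orbit d n ^ d dvd crit_orbit d (n + k) - crit_orbit d k"
proof -
  obtain j where k: "k = Suc j" using assms by (cases k) auto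
  show ?thesis
  proof (cases "d = 0")
    case False
    then have "crit_orbit d (Suc n) - crit_orbit d 1 = crit_orbit d n ^ d"
      by (simp add: crit_orbit_Suc power_0_left)
    then show ?thesis
      using unicritical_iterate_diff_dvd[of "crit_orbit d (Suc n)" "crit_orbit d 1" j "[:0, 1:]" d]
      unfolding crit_orbit_add[symmetric] k by simp
  qed simp
qed

text \<open>Shifting a positive time by \<open>n\<close> changes the orbit point by a multiple of
  \<open>crit_orbit d n ^ d\<close>, hence of its square as \<open>d >= 2\<close>. The result is
  sharper than \<open>orbit_diff_multiple\<close> at time 0, as no term with \<open>d\<close>
  appears.\<close>

lemma crit_orbit_multiple:
  assumes "d \<ge> 2" "n > 0" "j > 0"
  shows "\<exists>w. crit_orbit d (j * n) = crit_orbit d n * (1 + crit_orbit d n * w)"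
  using assms(3)
proof (induction j rule: nat_induct_non_zero)
  case 1
  show ?case by (auto intro!: exI[of _ 0])
next
  case (Suc j)
  obtain w where w: "crit_orbit d (j * n) = crit_orbit d n * (1 + crit_orbit d n * w)" using Suc by blast
  have "crit_orbit d n ^ 2 dvd crit_orbit d n ^ d" using assms by (simp add: le_imp_power_dvd)
  then have "crit_orbit d n ^ 2 dvd crit_orbit d (n + j * n) - crit_orbit d (j * n)"
    using crit_orbit_power_dvd_shift[of "j * n" d n] assms Suc.hyps dvd_trans by auto
  then obtain t where "crit_orbit d (n + j * n) - crit_orbit d (j * n) = crit_orbit d n ^ 2 * t" by blast
  then have "crit_orbit d (Suc j * n) = crit_orbit d (j * n) + crit_orbit d n ^ 2 * t"
    by (simp add: algebra_simps)
  then have "crit_orbit d (Suc j * n) = crit_orbit d n * (1 + crit_orbit d n * (w + t))"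
    unfolding w by (simp add: algebra_simps power2_eq_square)
  then show ?case by blast
qed

lemma diff_quotient_expand:
  assumes "d \<ge> 2" "n > 0"
  shows "\<exists>w. diff_quotient d m n = of_nat d * crit_orbit d m ^ (d - 1) + orbit_diff d m n * w"
proof -
  obtain w where w: "crit_orbit d (m + n) ^ d - crit_orbit d m ^ d
      = orbit_diff d m n * (of_nat d * crit_orbit d m ^ (d - 1) + orbit_diff d m n * w)"
    using power_diff_expand[of "crit_orbit d (m + n)" d "crit_orbit d m"] unfolding orbit_diff_def by blast
  have "orbit_diff d m n * diff_quotient d m n
      = orbit_diff d m n * (of_nat d * crit_orbit d m ^ (d - 1) + orbit_diff d m n * w)"
    unfolding orbit_diff_Suc[symmetric] w[symmetric] by (simp add: orbit_diff_def crit_orbit_Suc)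
  then have "diff_quotient d m n = of_nat d * crit_orbit d m ^ (d - 1) + orbit_diff d m n * w"
    using orbit_diff_nonzero[OF assms, of m] mult_left_cancel by blast
  then show ?thesis by blast
qed

text \<open>Both points have the form \<open>?a * (1 + ?a * _)\<close>, so each of the
  \<open>d\<close> summands is \<open>?a ^ (d - 1)\<close> times something congruent to 1 modulo
  \<open>?a\<close>; adding them produces the constant \<open>d\<close>.\<close>

lemma diff_quotient_expand_multiple:
  assumes "d \<ge> 2" "n > 0" "m > 0" "n dvd m"
  shows "\<exists>w. diff_quotient d m n = crit_orbit d n ^ (d - 1) * (of_nat d + crit_orbit d n * w)"
proof -
  let ?a = "crit_orbit d n"
  obtain j where j: "m = j * n" using assms by (metis dvdE mult.commute)
  have "j > 0" using assms j by (cases j) auto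
  then obtain w where w: "crit_orbit d m = ?a * (1 + ?a * w)"
    using crit_orbit_multiple[OF assms(1,2)] j by blast
  have "crit_orbit d (m + n) = crit_orbit d (Suc j * n)" using j by (simp add: add.commute)
  then obtain w' where w': "crit_orbit d (m + n) = ?a * (1 + ?a * w')"
    using crit_orbit_multiple[OF assms(1,2), of "Suc j"] by auto
  have one: "\<exists>t. (1 + ?a * x) ^ i = 1 + ?a * t" for x i
  proof -
    have "?a dvd (1 + ?a * x) ^ i - 1 ^ i"
      by (rule dvd_trans[OF _ power_diff_dvd]) simp
    then obtain t where "(1 + ?a * x) ^ i - 1 = ?a * t" by auto
    then have "(1 + ?a * x) ^ i = 1 + ?a * t" by (simp add: algebra_simps)
    then show ?thesis by blast
  qed
  have "\<exists>t. crit_orbit d m ^ (d - Suc i) * crit_orbit d (m + n) ^ i = ?a ^ (d - 1) * (1 + ?a * t)"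
    if "i < d" for i
  proof -
    obtain t t' where t: "(1 + ?a * w) ^ (d - Suc i) = 1 + ?a * t" "(1 + ?a * w') ^ i = 1 + ?a * t'"
      using one by blast
    have "d - 1 = (d - Suc i) + i" using that by simp
    then have "crit_orbit d m ^ (d - Suc i) * crit_orbit d (m + n) ^ i
        = ?a ^ (d - 1) * ((1 + ?a * t) * (1 + ?a * t'))"
      unfolding w w' t[symmetric] power_mult_distrib by (simp add: power_add)
    also have "(1 + ?a * t) * (1 + ?a * t') = 1 + ?a * (t + t' + ?a * t * t')"
      by (simp add: algebra_simps)
    finally show ?thesis by blast
  qed
  then obtain t where t: "\<And>i. i < d \<Longrightarrow>
      crit_orbit d m ^ (d - Suc i) * crit_orbit d (m + n) ^ i = ?a ^ (d - 1) * (1 + ?a * t i)"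
    by metis
  have "diff_quotient d m n = (\<Sum>i<d. ?a ^ (d - 1) * (1 + ?a * t i))"
    unfolding diff_quotient_def using t by (intro sum.cong) auto
  also have "\<dots> = ?a ^ (d - 1) * (of_nat d + ?a * (\<Sum>i<d. t i))"
    by (simp add: sum_distrib_left[symmetric] sum.distrib)
  finally show ?thesis by blast
qed

lemma G_poly_dvd:
  assumes "d \<ge> 2" "n > 0" "m > 0"
  shows "G_poly d m n dvd orbit_diff d m n"
  using G_poly_mult[OF assms] primitive_factor_dvd[OF assms(1,2), of m] by (metis dvd_mult_left)

text \<open>\<open>G_poly\<close> divides the primitive factor at time \<open>m\<close>, which is
  congruent to \<open>?A ^ (p ^ m)\<close> modulo \<open>p\<close>. So every prime ideal containing
  \<open>p\<close> and \<open>G_poly\<close> contains \<open>?A\<close>.\<close>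

lemma primitive_power_in_ideal_G_poly:
  assumes p: "prime p" and n: "n > 0" and m: "m > 0"
  shows "\<exists>E. primitive_factor p 0 n ^ E \<in> ideal2 (of_nat p) (G_poly p m n)"
proof -
  let ?A = "primitive_factor p 0 n"
  have "G_poly p m n dvd primitive_factor p m n"
    using G_poly_mult[OF prime_ge_2_nat[OF p] n m] by (metis dvd_triv_left)
  then have "primitive_factor p m n - (primitive_factor p m n - ?A ^ (p ^ m))
      \<in> ideal2 (of_nat p) (G_poly p m n)"
    using primitive_factor_mod_prime[OF p n, of m] by (intro ideal2_diff[OF ideal2_dvd2 ideal2_dvd1])
  then show ?thesis by auto
qed

text \<open>The last step before time \<open>m\<close> multiplies the orbit difference by
  \<open>diff_quotient\<close>, whose expansion has leading term \<open>p\<close> times a unit,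
  after removal of \<open>A ^ (p - 1)\<close> if \<open>n\<close> divides \<open>m - 1\<close>. The
  remaining terms are multiples of \<open>A\<close>.\<close>

lemma prime_unit_in_ideal_G_poly:
  assumes p: "prime p" and n: "n > 0" and m: "m \<ge> 2"
  shows "\<exists>R. unit_mod (ideal2 (of_nat p) (primitive_factor p 0 n)) R
    \<and> of_nat p * R \<in> ideal2 (G_poly p m n) (primitive_factor p 0 n)"
proof -
  note p2 = prime_ge_2_nat[OF p]
  define A where "A = primitive_factor p 0 n"
  define C where "C = primitive_cofactor p 0 n"
  define G where "G = G_poly p m n"
  \<comment> \<open>Positivity of \<open>M\<close> comes from \<open>m \<ge> 2\<close>; the
    expansion in the divisible case requires it.\<close>
  define M where "M = m - 1"
  define I where "I = ideal2 (of_nat p) A"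
  have M: "m = Suc M" "M > 0" using m by (auto simp: M_def)
  have an: "crit_orbit p n = A * C"
    using orbit_diff_factor[OF p2 n, of 0] by (simp add: A_def C_def)
  have C: "unit_mod I C" unfolding I_def A_def C_def by (rule primitive_cofactor_unit[OF p n])
  have CM: "unit_mod I (primitive_cofactor p M n)"
    using unit_mod_cong[OF unit_mod_power[OF C[unfolded I_def]]]
      ideal2_dvd1[OF primitive_cofactor_mod_prime[OF p n, of M]] unfolding I_def C_def by blast
  define K where "K = (if n dvd M then A ^ (p - 1) else 1)"
  have K0: "K \<noteq> 0" using primitive_factor_nonzero[OF p2 n] by (simp add: K_def A_def)
  have "primitive_factor p M n * (G * K * primitive_cofactor p m n)
      = primitive_factor p M n * (primitive_cofactor p M n * diff_quotient p M n)"
  proof -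
    have "primitive_factor p M n * (G * K * primitive_cofactor p m n) = orbit_diff p m n"
    proof -
      have "G * (primitive_factor p M n * K) = primitive_factor p m n"
        using G_poly_mult[OF p2 n, of m] M(1) unfolding G_def K_def A_def M_def by blast
      then show ?thesis
        unfolding orbit_diff_factor[OF p2 n, of m] by (metis mult.assoc mult.commute)
    qed
    also have "\<dots> = orbit_diff p M n * diff_quotient p M n" unfolding M(1) by (rule orbit_diff_Suc)
    finally show ?thesis unfolding orbit_diff_factor[OF p2 n, of M] by (simp add: ac_simps)
  qed
  \<comment> \<open>Two factorizations of the difference at time \<open>m\<close>, one through
    \<open>G\<close> and one through time \<open>M\<close>, are compared after cancelling their
    common primitive factor.\<close>
  then have key: "G * K * primitive_cofactor p m n = primitive_cofactor p M n * diff_quotient p M n"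
    using primitive_factor_nonzero[OF p2 n] by simp
  show ?thesis
  proof (cases "n dvd M")
    case True
    obtain w where w: "diff_quotient p M n = crit_orbit p n ^ (p - 1) * (of_nat p + crit_orbit p n * w)"
      using diff_quotient_expand_multiple[OF p2 n M(2) True] by blast
    let ?R = "primitive_cofactor p M n * C ^ (p - 1)"
    have "K * (G * primitive_cofactor p m n) = K * (?R * (of_nat p + A * (C * w)))"
    proof -
      have "K * (G * primitive_cofactor p m n) = G * K * primitive_cofactor p m n" by (simp only: ac_simps)
      also have "\<dots> = primitive_cofactor p M n * ((A * C) ^ (p - 1) * (of_nat p + A * C * w))"
        unfolding key w an ..
      also have "\<dots> = K * (?R * (of_nat p + A * (C * w)))"
        unfolding K_def power_mult_distrib using True by (simp only: ac_simps if_True)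
      finally show ?thesis .
    qed
    then have "G * primitive_cofactor p m n = ?R * (of_nat p + A * (C * w))"
      using K0 mult_left_cancel by blast
    then have "of_nat p * ?R = G * primitive_cofactor p m n + A * (- ?R * C * w)"
      by (simp only:) (simp add: algebra_simps)
    then have "of_nat p * ?R \<in> ideal2 G A" unfolding ideal2_def by blast
    moreover have "unit_mod I ?R"
      using CM C unfolding I_def by (intro unit_mod_mult unit_mod_power)
    ultimately show ?thesis unfolding I_def G_def A_def by blast
  next
    case False
    obtain w where w: "diff_quotient p M n = of_nat p * crit_orbit p M ^ (p - 1) + orbit_diff p M n * w"
      using diff_quotient_expand[OF p2 n] by blast
    have "A dvd orbit_diff p M n"
      using orbit_diff_dvd_mono[of 0 M p n] primitive_factor_dvd[OF p2 n, of 0] dvd_trans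
      unfolding A_def by blast
    then obtain v where v: "orbit_diff p M n = A * v" by blast
    let ?R = "primitive_cofactor p M n * crit_orbit p M ^ (p - 1)"
    have "G * primitive_cofactor p m n = primitive_cofactor p M n * diff_quotient p M n"
      using key False by (simp add: K_def)
    then have "of_nat p * ?R = G * primitive_cofactor p m n + A * (- primitive_cofactor p M n * v * w)"
      unfolding w v by (simp add: algebra_simps)
    then have "of_nat p * ?R \<in> ideal2 G A" unfolding ideal2_def by blast
    moreover have "unit_mod I ?R"
      using CM crit_orbit_unit[OF p n False] unfolding I_def A_def by (intro unit_mod_mult unit_mod_power)
    ultimately show ?thesis unfolding I_def G_def A_def by blast
  qed
qed

section \<open>Sums and products of algebraic integers\<close>

definition int_span :: "complex set \<Rightarrow> complex set" where
  "int_span W = {\<Sum>w\<in>W. of_int (a w) * w | a. True}"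

lemma int_span_0: "0 \<in> int_span W"
  unfolding int_span_def by (intro CollectI exI[of _ "\<lambda>_. 0"] conjI) simp_all

lemma int_span_add: "x \<in> int_span W \<Longrightarrow> y \<in> int_span W \<Longrightarrow> x + y \<in> int_span W"
  unfolding int_span_def
proof clarify
  fix a b :: "complex \<Rightarrow> int"
  show "\<exists>c. (\<Sum>w\<in>W. of_int (a w) * w) + (\<Sum>w\<in>W. of_int (b w) * w) = (\<Sum>w\<in>W. of_int (c w) * w) \<and> True"
    by (rule exI[of _ "\<lambda>w. a w + b w"]) (simp add: sum.distrib algebra_simps)
qed

lemma int_span_scale: "x \<in> int_span W \<Longrightarrow> of_int k * x \<in> int_span W"
  unfolding int_span_def
proof clarify
  fix a :: "complex \<Rightarrow> int"
  show "\<exists>c. of_int k * (\<Sum>w\<in>W. of_int (a w) * w) = (\<Sum>w\<in>W. of_int (c w) * w) \<and> True"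
    by (rule exI[of _ "\<lambda>w. k * a w"]) (simp add: sum_distrib_left algebra_simps)
qed

lemma int_span_sum:
  assumes "\<And>i. i \<in> I \<Longrightarrow> f i \<in> int_span W"
  shows "(\<Sum>i\<in>I. f i) \<in> int_span W"
  using assms
proof (induction I rule: infinite_finite_induct)
  case (insert i I)
  then show ?case by (simp add: int_span_add)
qed (simp_all add: int_span_0)

lemma int_span_base:
  assumes "finite W" "w \<in> W"
  shows "w \<in> int_span W"
proof -
  have "w = (\<Sum>v\<in>W. of_int (if v = w then 1 else 0) * v)"
    using assms by (subst sum.remove[of _ w]) auto
  then show ?thesis unfolding int_span_def
    by (intro CollectI exI[of _ "\<lambda>v. if v = w then 1 else 0"] conjI) auto
qed

lemma int_span_mult:
  assumes "\<And>w. w \<in> W \<Longrightarrow> x * w \<in> int_span W" "v \<in> int_span W"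
  shows "x * v \<in> int_span W"
proof -
  obtain a where v: "v = (\<Sum>w\<in>W. of_int (a w) * w)" using assms(2) unfolding int_span_def by blast
  have "x * v = (\<Sum>w\<in>W. of_int (a w) * (x * w))" unfolding v by (simp add: sum_distrib_left algebra_simps)
  then show ?thesis using assms(1) by (auto intro!: int_span_sum int_span_scale)
qed

text \<open>\<open>x\<close> is an eigenvalue of the integer matrix of multiplication by \<open>x\<close> on the generators.\<close>

lemma algebraic_int_if_int_span_stable:
  assumes fin: "finite W" and nz: "w\<^sub>0 \<in> W" "w\<^sub>0 \<noteq> 0" and st: "\<And>w. w \<in> W \<Longrightarrow> x * w \<in> int_span W"
  shows "algebraic_int x"
proof -
  obtain ws where ws: "set ws = W" "distinct ws" using finite_distinct_list[OF fin] by blast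
  define n where "n = length ws"
  have "\<forall>w\<in>W. \<exists>a. x * w = (\<Sum>v\<in>W. of_int (a v) * v)"
    using st unfolding int_span_def by blast
  then obtain a where a: "\<And>w. w \<in> W \<Longrightarrow> x * w = (\<Sum>v\<in>W. of_int (a w v) * v)" by metis
  define M where "M = mat n n (\<lambda>(i, j). a (ws ! i) (ws ! j))"
  define v where "v = vec n (\<lambda>i. ws ! i)"
  have M: "M \<in> carrier_mat n n" by (simp add: M_def)
  let ?M = "map_mat (of_int :: int \<Rightarrow> complex) M"
  have cM: "?M \<in> carrier_mat n n" using M by simp
  have bij: "bij_betw (\<lambda>i. ws ! i) {..<n} W"
    using ws bij_betw_nth[of ws "{..<n}" W] by (simp add: n_def)
  have eig: "?M *\<^sub>v v = x \<cdot>\<^sub>v v"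
  proof (rule eq_vecI)
    fix i assume "i < dim_vec (x \<cdot>\<^sub>v v)"
    then have i: "i < n" by (simp add: v_def)
    have wi: "ws ! i \<in> W" using i ws by (auto simp: n_def)
    have "(?M *\<^sub>v v) $ i = (\<Sum>j<n. of_int (a (ws ! i) (ws ! j)) * ws ! j)"
      using i by (simp add: M_def v_def scalar_prod_def lessThan_atLeast0)
    also have "\<dots> = (\<Sum>u\<in>W. of_int (a (ws ! i) u) * u)"
      by (rule sum.reindex_bij_betw[OF bij])
    also have "\<dots> = x * ws ! i" using a[OF wi] by simp
    finally show "(?M *\<^sub>v v) $ i = (x \<cdot>\<^sub>v v) $ i" using i by (simp add: v_def)
  qed (simp add: M_def v_def)
  obtain i where i: "i < n" "ws ! i = w\<^sub>0" using nz(1) ws by (metis in_set_conv_nth n_def)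
  have "v \<noteq> 0\<^sub>v n"
  proof
    assume "v = 0\<^sub>v n"
    then have "v $ i = 0" using i by simp
    then show False using i nz(2) by (simp add: v_def)
  qed
  then have "eigenvalue ?M x"
    unfolding eigenvalue_def eigenvector_def using eig M by (intro exI[of _ v]) (simp add: v_def)
  then have "poly (map_poly of_int (char_poly M)) x = 0"
    unfolding eigenvalue_root_char_poly[OF cM] of_int_hom.char_poly_hom[OF M] .
  moreover have "lead_coeff (char_poly M) = 1" using degree_monic_char_poly[OF M] by simp
  ultimately show ?thesis unfolding algebraic_int_altdef_ipoly by blast
qed

lemma algebraic_int_power_eq:
  fixes x :: complex
  assumes "algebraic_int x"
  shows "\<exists>N a. N > 0 \<and> x ^ N = (\<Sum>i<N. of_int (a i) * x ^ i)"
proof -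
  obtain p where p: "poly (map_poly of_int p) x = 0" "lead_coeff p = 1"
    using assms unfolding algebraic_int_altdef_ipoly by blast
  let ?N = "degree p"
  have "0 = (\<Sum>i\<le>?N. of_int (coeff p i) * x ^ i)"
    using p(1) by (simp add: poly_altdef)
  also have "{..?N} = insert ?N {..<?N}" by auto
  also have "(\<Sum>i\<in>\<dots>. of_int (coeff p i) * x ^ i) = x ^ ?N + (\<Sum>i<?N. of_int (coeff p i) * x ^ i)"
    using p(2) by simp
  finally have "x ^ ?N = - (\<Sum>i<?N. of_int (coeff p i) * x ^ i)"
    by (metis eq_neg_iff_add_eq_0)
  then have "x ^ ?N = (\<Sum>i<?N. of_int (- coeff p i) * x ^ i)"
    by (simp only: sum_negf[symmetric] of_int_minus mult_minus_left)
  moreover have "?N > 0"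
  proof (rule ccontr)
    assume "\<not> ?N > 0"
    then have "x ^ ?N = 1" "(\<Sum>i<?N. of_int (- coeff p i) * x ^ i) = 0" by simp_all
    then show False using calculation by (simp only: zero_neq_one simp_thms)
  qed
  ultimately show ?thesis by (intro exI[of _ ?N] exI[of _ "\<lambda>i. - coeff p i"] conjI)
qed

text \<open>The products of powers of \<open>x\<close> and \<open>y\<close> below the degrees of
  their integral equations work: these equations rewrite a power that reaches the degree.\<close>

lemma algebraic_int_common_span:
  fixes x y :: complex
  assumes "algebraic_int x" "algebraic_int y"
  shows "\<exists>W. finite W \<and> 1 \<in> W \<and> (\<forall>w\<in>W. x * w \<in> int_span W) \<and> (\<forall>w\<in>W. y * w \<in> int_span W)"
proof -
  obtain N a where N: "N > 0" "x ^ N = (\<Sum>i<N. of_int (a i) * x ^ i)"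
    using algebraic_int_power_eq[OF assms(1)] by blast
  obtain M b where M: "M > 0" "y ^ M = (\<Sum>i<M. of_int (b i) * y ^ i)"
    using algebraic_int_power_eq[OF assms(2)] by blast
  define W where "W = (\<lambda>(i, j). x ^ i * y ^ j) ` ({..<N} \<times> {..<M})"
  have fin: "finite W" by (simp add: W_def)
  have W: "x ^ i * y ^ j \<in> W" if "i < N" "j < M" for i j using that by (auto simp: W_def)
  have sp: "x ^ i * y ^ j \<in> int_span W" if "i < N" "j < M" for i j
    using int_span_base[OF fin W[OF that]] .
  have "1 \<in> W" using W[of 0 0] N(1) M(1) by simp
  moreover have "x * w \<in> int_span W" if "w \<in> W" for w
  proof -
    obtain i j where w: "w = x ^ i * y ^ j" "i < N" "j < M" using \<open>w \<in> W\<close> by (auto simp: W_def)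
    show ?thesis
    proof (cases "Suc i < N")
      case True
      then show ?thesis using sp[of "Suc i" j] w by (simp add: ac_simps)
    next
      case False
      then have "Suc i = N" using w by simp
      then have "x * w = x ^ N * y ^ j" unfolding w(1) by (simp flip: mult.assoc power_Suc)
      also have "\<dots> = (\<Sum>k<N. of_int (a k) * (x ^ k * y ^ j))"
        unfolding N(2) by (simp only: sum_distrib_right mult.assoc)
      finally have eq: "x * w = (\<Sum>k<N. of_int (a k) * (x ^ k * y ^ j))" .
      show ?thesis unfolding eq by (intro int_span_sum int_span_scale sp w(3)) simp
    qed
  qed
  moreover have "y * w \<in> int_span W" if "w \<in> W" for w
  proof -
    obtain i j where w: "w = x ^ i * y ^ j" "i < N" "j < M" using \<open>w \<in> W\<close> by (auto simp: W_def)
    show ?thesis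
    proof (cases "Suc j < M")
      case True
      then show ?thesis using sp[of i "Suc j"] w by (simp add: ac_simps)
    next
      case False
      then have "Suc j = M" using w by simp
      then have "y * w = x ^ i * y ^ M" unfolding w(1) by (metis mult.left_commute power_Suc)
      also have "\<dots> = (\<Sum>k<M. of_int (b k) * (x ^ i * y ^ k))"
        unfolding M(2) by (simp only: sum_distrib_left ac_simps)
      finally have eq: "y * w = (\<Sum>k<M. of_int (b k) * (x ^ i * y ^ k))" .
      show ?thesis unfolding eq by (intro int_span_sum int_span_scale sp w(2)) simp
    qed
  qed
  ultimately show ?thesis using fin by blast
qed

lemma algebraic_int_add:
  fixes x y :: complex
  assumes "algebraic_int x" "algebraic_int y"
  shows "algebraic_int (x + y)"
proof -
  obtain W where W: "finite W" "1 \<in> W" "\<And>w. w \<in> W \<Longrightarrow> x * w \<in> int_span W"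
      "\<And>w. w \<in> W \<Longrightarrow> y * w \<in> int_span W"
    using algebraic_int_common_span[OF assms] by blast
  show ?thesis
    using W by (intro algebraic_int_if_int_span_stable[of W 1]) (auto simp: distrib_right intro: int_span_add)
qed

lemma algebraic_int_mult:
  fixes x y :: complex
  assumes "algebraic_int x" "algebraic_int y"
  shows "algebraic_int (x * y)"
proof -
  obtain W where W: "finite W" "1 \<in> W" "\<And>w. w \<in> W \<Longrightarrow> x * w \<in> int_span W"
      "\<And>w. w \<in> W \<Longrightarrow> y * w \<in> int_span W"
    using algebraic_int_common_span[OF assms] by blast
  show ?thesis
    using W by (intro algebraic_int_if_int_span_stable[of W 1]) (auto simp: mult.assoc intro: int_span_mult)
qed

lemma algebraic_int_diff:
  fixes x y :: complex
  shows "algebraic_int x \<Longrightarrow> algebraic_int y \<Longrightarrow> algebraic_int (x - y)"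
  using algebraic_int_add[of x "- y"] by simp

lemma algebraic_int_sum:
  fixes f :: "'a \<Rightarrow> complex"
  shows "(\<And>i. i \<in> A \<Longrightarrow> algebraic_int (f i)) \<Longrightarrow> algebraic_int (\<Sum>i\<in>A. f i)"
  by (induction A rule: infinite_finite_induct) (simp_all add: algebraic_int_add)

lemma algebraic_int_power:
  fixes x :: complex
  shows "algebraic_int x \<Longrightarrow> algebraic_int (x ^ n)"
  by (induction n) (simp_all add: algebraic_int_mult)

lemma algebraic_int_poly:
  fixes x :: complex
  assumes "algebraic_int x" "\<And>i. algebraic_int (coeff f i)"
  shows "algebraic_int (poly f x)"
  unfolding poly_altdef
  by (rule algebraic_int_sum) (rule algebraic_int_mult[OF assms(2) algebraic_int_power[OF assms(1)]])

lemma algebraic_int_poly_of_int: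
  fixes x :: complex
  assumes "algebraic_int x"
  shows "algebraic_int (poly (map_poly of_int f) x)"
  using assms by (rule algebraic_int_poly) (simp add: int_imp_algebraic_int)

section \<open>Saturation at the prime\<close>

definition int_eval :: "complex \<Rightarrow> int poly \<Rightarrow> complex" where
  "int_eval c f = poly (map_poly of_int f) c"

lemma int_eval_add [simp]: "int_eval c (f + g) = int_eval c f + int_eval c g"
  and int_eval_diff [simp]: "int_eval c (f - g) = int_eval c f - int_eval c g"
  and int_eval_mult [simp]: "int_eval c (f * g) = int_eval c f * int_eval c g"
  and int_eval_power [simp]: "int_eval c (f ^ n) = int_eval c f ^ n"
  and int_eval_0 [simp]: "int_eval c 0 = 0"
  and int_eval_1 [simp]: "int_eval c 1 = 1"
  and int_eval_uminus [simp]: "int_eval c (- f) = - int_eval c f"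
  and int_eval_of_nat [simp]: "int_eval c (of_nat k) = of_nat k"
  and int_eval_of_int [simp]: "int_eval c (of_int i) = of_int i"
  and int_eval_const: "int_eval c [:i:] = of_int i"
  and int_eval_X [simp]: "int_eval c [:0, 1:] = c"
  by (simp_all add: int_eval_def hom_distribs of_nat_poly of_int_poly)

abbreviation int_evals :: "complex \<Rightarrow> complex set" where
  "int_evals c \<equiv> range (int_eval c)"

lemma int_evals_add: "x \<in> int_evals c \<Longrightarrow> y \<in> int_evals c \<Longrightarrow> x + y \<in> int_evals c"
  by (auto simp flip: int_eval_add)

lemma int_evals_diff: "x \<in> int_evals c \<Longrightarrow> y \<in> int_evals c \<Longrightarrow> x - y \<in> int_evals c"
  by (auto simp flip: int_eval_diff)

lemma int_evals_mult: "x \<in> int_evals c \<Longrightarrow> y \<in> int_evals c \<Longrightarrow> x * y \<in> int_evals c"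
  by (auto simp flip: int_eval_mult)

lemma int_evals_power: "x \<in> int_evals c \<Longrightarrow> x ^ n \<in> int_evals c"
  by (auto simp flip: int_eval_power)

lemma int_evals_of_int: "of_int i \<in> int_evals c"
  by (metis int_eval_of_int rangeI)

lemma int_evals_sum: "(\<And>i. i \<in> A \<Longrightarrow> f i \<in> int_evals c) \<Longrightarrow> sum f A \<in> int_evals c"
  by (induction A rule: infinite_finite_induct)
    (simp_all add: int_evals_add int_evals_of_int[of 0, simplified])

lemma prime_power_dvd_power_add_diff:
  fixes x y :: "'a::comm_ring_1"
  assumes "prime p"
  shows "of_nat p dvd (x + y) ^ (p ^ n) - (x ^ (p ^ n) + y ^ (p ^ n))"
proof (induction n)
  case (Suc n)
  have "of_nat p dvd ((x + y) ^ (p ^ n)) ^ p - (x ^ (p ^ n) + y ^ (p ^ n)) ^ p"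
    using Suc power_diff_dvd dvd_trans by blast
  then have "of_nat p dvd ((x + y) ^ (p ^ n)) ^ p - ((x ^ (p ^ n)) ^ p + (y ^ (p ^ n)) ^ p)"
    using prime_dvd_power_add_diff[OF assms] by (rule dvd_diff_trans)
  then show ?case by (simp only: power_mult[symmetric] power_Suc mult.commute)
qed simp

text \<open>By Frobenius, the elements fixed by the \<open>p ^ n\<close>-th power modulo the ideal
  form a subring. It contains the indeterminate by hypothesis, hence every integer
  polynomial.\<close>

lemma power_fixes_poly_mod_ideal:
  fixes f A :: "int poly"
  assumes p: "prime p" and X: "[:0, 1:] ^ (p ^ n) - [:0, 1:] \<in> ideal2 (of_nat p) A"
  shows "f ^ (p ^ n) - f \<in> ideal2 (of_nat p) A"
proof -
  define q where "q = p ^ n"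
  define I where "I = ideal2 (of_nat p) A"
  have q0: "q > 0" using prime_gt_0_nat[OF p] by (simp add: q_def)
  have add: "(f + g) ^ q - (f + g) \<in> I" if "f ^ q - f \<in> I" "g ^ q - g \<in> I" for f g
  proof -
    have "(f + g) ^ q - (f ^ q + g ^ q) \<in> I" unfolding q_def I_def
      by (rule ideal2_dvd1[OF prime_power_dvd_power_add_diff[OF p]])
    then have "((f + g) ^ q - (f ^ q + g ^ q)) + ((f ^ q - f) + (g ^ q - g)) \<in> I"
      using that unfolding I_def by (intro ideal2_add)
    then show ?thesis by (simp add: algebra_simps)
  qed
  \<comment> \<open>Additivity applied to \<open>f\<close> and \<open>- f\<close> avoids a case
    distinction on the parity of \<open>q\<close>.\<close>
  have neg: "(- f) ^ q - (- f) \<in> I" if "f ^ q - f \<in> I" for f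
  proof -
    have "(f + (- f)) ^ q - (f ^ q + (- f) ^ q) \<in> I" unfolding q_def I_def
      by (rule ideal2_dvd1[OF prime_power_dvd_power_add_diff[OF p]])
    then have "0 - (((f + (- f)) ^ q - (f ^ q + (- f) ^ q)) + (f ^ q - f)) \<in> I"
      using that unfolding I_def by (intro ideal2_diff[OF ideal2_dvd1[of _ 0] ideal2_add]) simp_all
    then show ?thesis using q0 by (simp add: power_0_left add.commute)
  qed
  have mult: "(f * g) ^ q - f * g \<in> I" if "f ^ q - f \<in> I" "g ^ q - g \<in> I" for f g
  proof -
    have "f ^ q * (g ^ q - g) + (f ^ q - f) * g \<in> I"
      using that unfolding I_def by (intro ideal2_add ideal2_mult ideal2_mult_left)
    then show ?thesis by (simp add: algebra_simps power_mult_distrib)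
  qed
  have zero: "0 ^ q - 0 \<in> I" and one: "1 ^ q - 1 \<in> I"
    using q0 ideal2_dvd1[of "of_nat p" 0 A] by (simp_all add: power_0_left I_def)
  have int: "(of_int i) ^ q - of_int i \<in> I" for i
  proof (induction i rule: int_induct[where k = 0])
    case base
    then show ?case using zero by simp
  next
    case (step1 i)
    then show ?case using add[OF step1(2) one] by simp
  next
    case (step2 i)
    then show ?case using add[OF step2(2) neg[OF one]] by simp
  qed
  have "f ^ q - f \<in> I"
  proof (induction f)
    case 0
    show ?case by (rule zero)
  next
    case (pCons a f)
    have eq: "pCons a f = of_int a + [:0, 1:] * f" by (simp add: of_int_poly)
    show ?case unfolding eq by (rule add[OF int mult[OF X[folded q_def I_def] pCons(2)]])
  qed
  then show ?thesis by (simp add: q_def I_def)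
qed

lemma power_power_fixes_poly_mod_ideal:
  fixes f A :: "int poly"
  assumes "prime p" "[:0, 1:] ^ (p ^ n) - [:0, 1:] \<in> ideal2 (of_nat p) A"
  shows "f ^ ((p ^ n) ^ k) - f \<in> ideal2 (of_nat p) A"
proof (induction k)
  case 0
  show ?case using ideal2_dvd1[of "of_nat p" 0 A] by simp
next
  case (Suc k)
  have "((f ^ ((p ^ n) ^ k)) ^ (p ^ n) - f ^ ((p ^ n) ^ k)) + (f ^ ((p ^ n) ^ k) - f) \<in> ideal2 (of_nat p) A"
    by (rule ideal2_add[OF power_fixes_poly_mod_ideal[OF assms] Suc])
  then show ?case by (simp add: power_mult[symmetric] mult.commute)
qed

text \<open>
  Locally at the maximal ideals containing \<open>p\<close> the hypotheses say that the ideal \<open>(p, A)\<close> is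
  radical and generated by \<open>A\<close>, so that \<open>\<int>[c]\<close> is regular there.
\<close>

lemma int_evals_p_saturated:
  fixes G A R :: "int poly"
  assumes p: "prime p" and n: "n > 0" and c: "algebraic_int c" and G: "int_eval c G = 0"
    and nil: "A ^ E \<in> ideal2 (of_nat p) G"
    and R: "unit_mod (ideal2 (of_nat p) A) R" "of_nat p * R \<in> ideal2 G A"
    and X: "[:0, 1:] ^ (p ^ n) - [:0, 1:] \<in> ideal2 (of_nat p) A"
    and x: "algebraic_int x" "of_nat p * x \<in> int_evals c"
  shows "x \<in> int_evals c"
proof (rule ccontr)
  assume xB: "x \<notin> int_evals c"
  let ?B = "int_evals c"
  define \<pi> where "\<pi> = int_eval c A"
  have p0: "(of_nat p :: complex) \<noteq> 0" using p by auto
  have \<pi>B: "\<pi> \<in> ?B" by (simp add: \<pi>_def)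
  obtain u0 v0 where "A ^ E = of_nat p * u0 + G * v0" using nil unfolding ideal2_def by blast
  then have "\<pi> ^ E = of_nat p * int_eval c u0"
    unfolding \<pi>_def using G by (metis add.right_neutral int_eval_add int_eval_mult int_eval_of_nat int_eval_power mult_zero_left)
  then have "\<pi> ^ E * x = int_eval c u0 * (of_nat p * x)" by (simp add: ac_simps)
  then have ex: "\<pi> ^ E * x \<in> ?B" by (simp only: int_evals_mult[OF rangeI x(2)])
  define j where "j = (LEAST e. \<pi> ^ e * x \<in> ?B)"
  have j: "\<pi> ^ j * x \<in> ?B" unfolding j_def using ex by (rule LeastI)
  have j0: "j \<noteq> 0" using j xB by (metis mult_1 power_0)
  \<comment> \<open>By minimality of \<open>j\<close>, \<open>y\<close> is still outside
    \<open>\<int>[c]\<close> while \<open>\<pi> * y\<close> is inside. It remains integral and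
    \<open>p * y\<close> remains in \<open>\<int>[c]\<close>, so \<open>y\<close> may replace
    \<open>x\<close>.\<close>
  define y where "y = \<pi> ^ (j - 1) * x"
  have yB: "y \<notin> ?B" unfolding y_def j_def using j0 not_less_Least[of "j - 1" "\<lambda>e. \<pi> ^ e * x \<in> ?B"]
    by (simp add: j_def)
  have "\<pi> * y = \<pi> ^ j * x" unfolding y_def using j0 by (simp add: power_eq_if mult.assoc)
  then have \<pi>y: "\<pi> * y \<in> ?B" using j by simp
  have "of_nat p * y = \<pi> ^ (j - 1) * (of_nat p * x)" by (simp add: y_def)
  then have py: "of_nat p * y \<in> ?B" by (simp only: int_evals_mult[OF int_evals_power[OF \<pi>B] x(2)])
  have y_int: "algebraic_int y"
    unfolding y_def \<pi>_def int_eval_def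
    by (intro algebraic_int_mult algebraic_int_power algebraic_int_poly_of_int c x)
  obtain f where f: "\<pi> * y = int_eval c f" using \<pi>y by blast
  obtain N a where N: "N > 0" "y ^ N = (\<Sum>i<N. of_int (a i) * y ^ i)"
    using algebraic_int_power_eq[OF y_int] by blast
  \<comment> \<open>Multiplying the integral equation of \<open>y\<close> by
    \<open>\<pi> ^ N\<close> leaves at least one spare factor \<open>\<pi>\<close> in each term, so
    \<open>\<pi>\<close> divides \<open>(\<pi> * y) ^ N\<close> inside
    \<open>\<int>[c]\<close>.\<close>
  have "(\<pi> * y) ^ N = \<pi> * (\<Sum>i<N. of_int (a i) * (\<pi> ^ (N - Suc i) * (\<pi> * y) ^ i))"
  proof -
    have "(\<pi> * y) ^ N = (\<Sum>i<N. of_int (a i) * (\<pi> ^ N * y ^ i))"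
      unfolding power_mult_distrib N(2) sum_distrib_left by (simp only: ac_simps)
    also have "\<dots> = (\<Sum>i<N. \<pi> * (of_int (a i) * (\<pi> ^ (N - Suc i) * (\<pi> * y) ^ i)))"
    proof (rule sum.cong[OF refl])
      fix i assume "i \<in> {..<N}"
      then have "N = Suc ((N - Suc i) + i)" by simp
      then have "\<pi> ^ N = \<pi> * (\<pi> ^ (N - Suc i) * \<pi> ^ i)" by (metis power_Suc power_add)
      then show "of_int (a i) * (\<pi> ^ N * y ^ i) = \<pi> * (of_int (a i) * (\<pi> ^ (N - Suc i) * (\<pi> * y) ^ i))"
        by (simp add: power_mult_distrib)
    qed
    finally show ?thesis by (simp only: sum_distrib_left)
  qed
  moreover have "(\<Sum>i<N. of_int (a i) * (\<pi> ^ (N - Suc i) * (\<pi> * y) ^ i)) \<in> ?B"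
    by (intro \<pi>y int_evals_sum int_evals_mult int_evals_power int_evals_of_int \<pi>B)
  ultimately obtain b where b: "b \<in> ?B" "(\<pi> * y) ^ N = \<pi> * b" by (rule that[rotated])
  \<comment> \<open>This exponent is at least \<open>N\<close>, so \<open>\<pi>\<close> still
    divides the \<open>q\<close>-th power, and the \<open>q\<close>-th power is the identity modulo
    \<open>p\<close> and \<open>A\<close>. Hence \<open>\<pi> * y\<close> is itself a multiple of
    \<open>\<pi>\<close> modulo \<open>p\<close>.\<close>
  define q where "q = (p ^ n) ^ N"
  have "N \<le> q"
  proof -
    have "p ^ n \<ge> 2" using prime_ge_2_nat[OF p] self_le_power[of p n] n by simp
    then have "2 ^ N \<le> q" unfolding q_def by (rule power_mono) simp
    then show ?thesis using less_exp[of N] by linarith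
  qed
  obtain s t where st: "f ^ q - f = of_nat p * s + A * t"
    using power_power_fixes_poly_mod_ideal[OF p X, of f N] unfolding q_def ideal2_def by blast
  have "(\<pi> * y) ^ q - \<pi> * y = of_nat p * int_eval c s + \<pi> * int_eval c t"
    using arg_cong[OF st, of "int_eval c"] unfolding f by (simp add: \<pi>_def)
  moreover have "(\<pi> * y) ^ q = \<pi> * (b * (\<pi> * y) ^ (q - N))"
    using \<open>N \<le> q\<close> b(2) by (metis le_add_diff_inverse mult.assoc power_add)
  ultimately have eq: "\<pi> * (y - (b * (\<pi> * y) ^ (q - N) - int_eval c t)) = of_nat p * int_eval c (- s)"
    by (simp add: algebra_simps)
  \<comment> \<open>Subtracting an element of \<open>\<int>[c]\<close> improves the relation:
    \<open>\<pi> * y'\<close> lies even in \<open>p * \<int>[c]\<close>.\<close>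
  define y' where "y' = y - (b * (\<pi> * y) ^ (q - N) - int_eval c t)"
  have tB: "b * (\<pi> * y) ^ (q - N) - int_eval c t \<in> ?B"
    by (intro \<pi>y b int_evals_diff int_evals_mult int_evals_power rangeI)
  have py': "of_nat p * y' \<in> ?B"
    unfolding y'_def right_diff_distrib
    using int_evals_diff[OF py int_evals_mult[OF int_evals_of_int[of "int p"] tB]]
    by (simp add: right_diff_distrib)
  have \<pi>y': "\<pi> * y' = of_nat p * int_eval c (- s)" using eq by (simp only: y'_def)
  \<comment> \<open>Since \<open>p * R\<close> evaluates to a multiple of \<open>\<pi>\<close>, the
    product of \<open>y'\<close> with \<open>p * R * S\<close> lies in \<open>p * \<int>[c]\<close>,
    and \<open>p\<close> cancels. Replacing \<open>R * S\<close> by 1 costs multiples of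
    \<open>p * y'\<close> and \<open>\<pi> * y'\<close>, both in \<open>\<int>[c]\<close>.\<close>
  obtain S u v where S: "R * S - 1 = of_nat p * u + A * v"
    using R(1) unfolding unit_mod_def ideal2_def by blast
  obtain g1 g2 where g: "of_nat p * R = G * g1 + A * g2" using R(2) unfolding ideal2_def by blast
  have 1: "int_eval c R * int_eval c S = 1 + of_nat p * int_eval c u + \<pi> * int_eval c v"
    using arg_cong[OF S, of "int_eval c"] by (simp add: \<pi>_def algebra_simps)
  have 2: "of_nat p * int_eval c R = \<pi> * int_eval c g2"
    using arg_cong[OF g, of "int_eval c"] G by (simp add: \<pi>_def)
  have "of_nat p * (y' * (int_eval c R * int_eval c S)) = (of_nat p * int_eval c R) * (int_eval c S * y')"
    by (simp only: ac_simps)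
  also have "\<dots> = (\<pi> * y') * (int_eval c g2 * int_eval c S)" unfolding 2 by (simp only: ac_simps)
  also have "\<dots> = of_nat p * (int_eval c (- s) * (int_eval c g2 * int_eval c S))"
    unfolding \<pi>y' by (simp only: ac_simps)
  finally have "y' * (int_eval c R * int_eval c S) = int_eval c (- s) * (int_eval c g2 * int_eval c S)"
    using p0 mult_left_cancel by blast
  then have "y' = int_eval c (- s) * (int_eval c g2 * int_eval c S)
      - ((of_nat p * y') * int_eval c u + (of_nat p * int_eval c (- s)) * int_eval c v)"
    unfolding 1 \<pi>y'[symmetric] by (simp add: algebra_simps)
  moreover have "\<dots> \<in> ?B"
    using int_evals_of_int[of "int p"]
    by (intro py' rangeI int_evals_diff int_evals_add int_evals_mult) simp_all
  ultimately have "y' \<in> ?B" by (simp only:)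
  then have "y \<in> ?B" using int_evals_add[OF _ tB, of y'] by (simp add: y'_def)
  then show False using yB by contradiction
qed

section \<open>Finiteness of the index\<close>

text \<open>A monic integer polynomial of least degree vanishing at \<open>c\<close> works. In any
  factorization the leading coefficients are 1 or -1, so up to sign the factor vanishing at
  \<open>c\<close> is monic and has full degree.\<close>

lemma algebraic_int_monic_prime_poly:
  assumes "algebraic_int c"
  shows "\<exists>h. prime_elem h \<and> lead_coeff h = 1 \<and> degree h > 0 \<and> int_eval c h = 0"
proof -
  let ?Q = "\<lambda>k. \<exists>h. lead_coeff h = 1 \<and> int_eval c h = 0 \<and> degree h = k"
  have "\<exists>k. ?Q k" using assms unfolding algebraic_int_altdef_ipoly int_eval_def by blast
  then have "?Q (LEAST k. ?Q k)" by (rule LeastI_ex)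
  then obtain h where h: "lead_coeff h = 1" "int_eval c h = 0" "degree h = (LEAST k. ?Q k)" by blast
  have min: "degree h \<le> degree f" if "lead_coeff f = 1" "int_eval c f = 0" for f
    unfolding h(3) using that by (intro Least_le) blast
  have deg: "degree h > 0"
  proof (rule ccontr)
    assume "\<not> degree h > 0"
    then have "h = [:1:]" using h(1) by (metis degree_0_id not_gr0 degree_eq_zeroE lead_coeff_pCons(2) pCons_0_0 coeff_pCons_0)
    then show False using h(2) by (simp add: int_eval_const)
  qed
  have unit: "is_unit b" if "h = a * b" "int_eval c a = 0" for a b
  proof -
    have lc: "lead_coeff a * lead_coeff b = 1" using h(1) unfolding that by (simp add: lead_coeff_mult)
    then have "lead_coeff a = 1 \<or> lead_coeff a = - 1" using zmult_eq_1_iff by blast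
    then have "degree h \<le> degree a"
    proof
      assume "lead_coeff a = - 1"
      then show ?thesis using min[of "- a"] that(2) by (simp add: lead_coeff_minus)
    qed (use min that(2) in blast)
    moreover have "a \<noteq> 0" "b \<noteq> 0" using lc by auto
    then have "degree h = degree a + degree b" using that(1) by (simp add: degree_mult_eq)
    ultimately have "degree b = 0" by simp
    then obtain e where e: "b = [:e:]" by (rule degree_eq_zeroE)
    then have "is_unit e" using lc by (metis degree_pCons_0 coeff_pCons_0 dvd_triv_right)
    then show ?thesis unfolding e by (simp add: is_unit_const_poly_iff)
  qed
  have "irreducible h"
  proof (rule irreducibleI)
    show "h \<noteq> 0" using deg by auto
    show "\<not> is_unit h" using deg by (auto simp: is_unit_poly_iff)
    fix a b assume ab: "h = a * b"
    then have "int_eval c a = 0 \<or> int_eval c b = 0" using h(2) by simp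
    then show "is_unit a \<or> is_unit b" using unit[OF ab] unit[of b a] ab by (auto simp: mult.commute)
  qed
  then show ?thesis using h deg by (intro exI[of _ h]) (simp add: irreducible_imp_prime_elem)
qed

text \<open>By pseudo-division, a nonzero element \<open>g\<close> of least degree in the ideal
  divides nonzero constant multiples of \<open>h\<close> and of \<open>f\<close>. Primality of
  \<open>h\<close> then forces \<open>g\<close> to be constant.\<close>

lemma prime_poly_bezout:
  fixes h f :: "int poly"
  assumes h: "prime_elem h" "degree h > 0" and f: "\<not> h dvd f"
  shows "\<exists>u v D. D \<noteq> 0 \<and> h * u + f * v = [:D:]"
proof -
  let ?J = "ideal2 h f"
  let ?Q = "\<lambda>k. \<exists>g\<in>?J. g \<noteq> 0 \<and> degree g = k"
  have hJ: "h \<in> ?J" and fJ: "f \<in> ?J" by (simp_all add: ideal2_dvd1 ideal2_dvd2)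
  have h0: "h \<noteq> 0" using h by auto
  have "\<exists>k. ?Q k" using hJ h0 by blast
  then have "?Q (LEAST k. ?Q k)" by (rule LeastI_ex)
  then obtain g where g: "g \<in> ?J" "g \<noteq> 0" "degree g = (LEAST k. ?Q k)" by blast
  have min: "degree g \<le> degree k" if "k \<in> ?J" "k \<noteq> 0" for k
    unfolding g(3) using that by (intro Least_le) blast
  have dvd: "\<exists>a. a \<noteq> 0 \<and> g dvd [:a:] * k" if k: "k \<in> ?J" for k
  proof -
    obtain a q where aq: "a \<noteq> 0" "smult a k = g * q + pseudo_mod k g"
      and r: "pseudo_mod k g = 0 \<or> degree (pseudo_mod k g) < degree g"
      using pseudo_mod[OF g(2), of k] by blast
    have "pseudo_mod k g = k * [:a:] - g * q" using aq(2) by simp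
    then have "pseudo_mod k g \<in> ?J" using k g(1) by (simp only: ideal2_diff ideal2_mult)
    then have "pseudo_mod k g = 0" using r min by (meson not_le)
    then have "g dvd [:a:] * k" using aq(2) by simp
    then show ?thesis using aq(1) by blast
  qed
  obtain a where a: "a \<noteq> 0" "g dvd [:a:] * h" using dvd[OF hJ] by blast
  obtain b where b: "b \<noteq> 0" "g dvd [:b:] * f" using dvd[OF fJ] by blast
  have const: "\<not> h dvd [:e:]" if "e \<noteq> 0" for e
    using dvd_imp_degree_le[of h "[:e:]"] that h(2) by auto
  obtain q where q: "[:a:] * h = g * q" using a(2) by blast
  then have "h dvd g * q" by (metis dvd_triv_right)
  moreover have "\<not> h dvd g"
  proof
    assume "h dvd g"
    then have "h dvd [:b:] * f" using b(2) dvd_trans by blast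
    then show False using prime_elem_dvd_mult_iff[OF h(1)] const[OF b(1)] f by blast
  qed
  ultimately obtain q' where "q = h * q'" using prime_elem_dvd_mult_iff[OF h(1)] by blast
  then have "h * [:a:] = h * (g * q')" using q by (simp only: ac_simps)
  then have "[:a:] = g * q'" using h0 mult_left_cancel by blast
  then have "g dvd [:a:]" by simp
  then have "degree g = 0" using dvd_imp_degree_le[of g "[:a:]"] a(1) by simp
  then obtain D where D: "g = [:D:]" by (rule degree_eq_zeroE)
  obtain u v where "g = h * u + f * v" using g(1) unfolding ideal2_def by blast
  then show ?thesis using g(2) unfolding D by (metis pCons_0_0)
qed

lemma prime_poly_dvd_if_root:
  assumes "prime_elem h" "degree h > 0" "int_eval c h = 0" "int_eval c f = 0"
  shows "h dvd f"
proof (rule ccontr)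
  assume "\<not> h dvd f"
  then obtain u v D where D: "D \<noteq> 0" "h * u + f * v = [:D:]"
    using prime_poly_bezout assms by blast
  have "int_eval c [:D:] = 0" unfolding D(2)[symmetric] using assms by simp
  then show False using D(1) by (simp add: int_eval_const)
qed

lemma monic_poly_division:
  fixes f h :: "int poly"
  assumes "lead_coeff h = 1"
  shows "\<exists>q r. f = h * q + r \<and> (r = 0 \<or> degree r < degree h)"
proof -
  obtain q r where qr: "pseudo_divmod f h = (q, r)" by (cases "pseudo_divmod f h")
  have "h \<noteq> 0" using assms by auto
  from pseudo_divmod[OF this qr] show ?thesis using assms by auto
qed

lemma int_eval_altdef: "int_eval c f = (\<Sum>i\<le>degree f. of_int (coeff f i) * c ^ i)"
  by (simp add: int_eval_def poly_altdef)

text \<open>Clearing denominators in an integral equation of \<open>x\<close> gives an integer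
  polynomial \<open>f\<close> vanishing at \<open>c\<close>. It is divisible by \<open>h\<close>, so
  it vanishes at the conjugate \<open>\<gamma>\<close> too, where it is an integral equation of the
  conjugate of \<open>x\<close>.\<close>

lemma algebraic_int_conjugate:
  assumes h: "prime_elem h" "degree h > 0" "int_eval c h = 0"
    and D: "D \<noteq> 0" and x: "algebraic_int x" "of_int D * x = int_eval c g"
    and \<gamma>: "int_eval \<gamma> h = 0"
  shows "algebraic_int (int_eval \<gamma> g / of_int D)"
proof -
  obtain \<mu> where \<mu>: "int_eval x \<mu> = 0" "lead_coeff \<mu> = 1"
    using x(1) unfolding algebraic_int_altdef_ipoly int_eval_def by blast
  let ?N = "degree \<mu>"
  define f where "f = (\<Sum>i\<le>?N. of_int (coeff \<mu> i * D ^ (?N - i)) * g ^ i)"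
  have ev_sum: "int_eval z (sum F S) = (\<Sum>i\<in>S. int_eval z (F i))" for z and F :: "nat \<Rightarrow> int poly" and S
    by (induction S rule: infinite_finite_induct) simp_all
  have f: "int_eval z f = of_int D ^ ?N * int_eval (int_eval z g / of_int D) \<mu>" for z
  proof -
    have "int_eval z f = (\<Sum>i\<le>?N. of_int (coeff \<mu> i) * of_int D ^ (?N - i) * int_eval z g ^ i)"
      unfolding f_def ev_sum int_eval_mult int_eval_of_int int_eval_power of_int_mult of_int_power ..
    also have "\<dots> = (\<Sum>i\<le>?N. of_int D ^ ?N * (of_int (coeff \<mu> i) * (int_eval z g / of_int D) ^ i))"
      using D by (intro sum.cong refl) (simp add: power_diff power_divide)
    also have "\<dots> = of_int D ^ ?N * int_eval (int_eval z g / of_int D) \<mu>"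
      unfolding int_eval_altdef[of _ \<mu>] sum_distrib_left ..
    finally show ?thesis .
  qed
  have "int_eval c g / of_int D = x" using x(2) D by (simp add: field_simps)
  then have "int_eval c f = 0" using f[of c] \<mu>(1) by simp
  then have "h dvd f" using prime_poly_dvd_if_root[OF h] by simp
  then have "int_eval \<gamma> f = 0" using \<gamma> by (auto elim!: dvdE)
  then have "int_eval (int_eval \<gamma> g / of_int D) \<mu> = 0" using f[of \<gamma>] D by simp
  then show ?thesis unfolding algebraic_int_altdef_ipoly using \<mu>(2) unfolding int_eval_def by blast
qed

lemma algebraic_int_coeff_prod_linear:
  fixes Z :: "complex set"
  assumes "\<And>z. z \<in> Z \<Longrightarrow> algebraic_int z"
  shows "algebraic_int (coeff (\<Prod>z\<in>Z. [:- z, 1:]) i)"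
  using assms
proof (induction Z arbitrary: i rule: infinite_finite_induct)
  case (insert z Z)
  have "coeff ([:- z, 1:] * P) i = (case i of 0 \<Rightarrow> 0 | Suc j \<Rightarrow> coeff P j) - z * coeff P i" for P
    by (simp add: coeff_pCons split: nat.split)
  then show ?case using insert
    by (simp add: algebraic_int_diff algebraic_int_mult split: nat.split del: mult_pCons_left)
qed (simp_all add: int_imp_algebraic_int)

lemma int_coeff_poly_in_int_evals:
  assumes "\<And>i. coeff f i \<in> \<int>"
  shows "poly f c \<in> int_evals c"
proof -
  have "c ^ i \<in> int_evals c" for i by (metis int_eval_X int_evals_power rangeI)
  moreover have "coeff f i \<in> int_evals c" for i using assms[of i] int_evals_of_int by (auto elim!: Ints_cases)
  ultimately show ?thesis unfolding poly_altdef by (intro int_evals_sum int_evals_mult)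
qed

lemma degree_prod_linear: "degree (\<Prod>z\<in>Z. [:- z, 1 :: complex:]) = card Z"
  by (induction Z rule: infinite_finite_induct) (simp_all add: degree_mult_eq del: mult_pCons_left)

text \<open>
  Lagrange interpolation at the roots of \<open>h\<close> writes a multiple of \<open>x\<close> by a discriminant-like integer
  as a polynomial in \<open>c\<close> whose coefficients are at once rational and algebraic integers.
\<close>

lemma discriminant_mult_in_int_evals:
  assumes h: "prime_elem h" "lead_coeff h = 1" "degree h > 0" "int_eval c h = 0"
    and \<Delta>: "\<Delta> \<noteq> 0" "h * u + pderiv h * v = [:\<Delta>:]"
    and D: "D \<noteq> 0" and x: "algebraic_int x" "of_int D * x \<in> int_evals c"
  shows "of_int \<Delta> * x \<in> int_evals c"
proof -
  obtain g where g: "of_int D * x = int_eval c g" using x(2) by blast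
  obtain q r where qr: "g = h * q + r" "r = 0 \<or> degree r < degree h"
    using monic_poly_division[OF h(2)] by blast
  have xr: "of_int D * x = int_eval c r" using g qr(1) h(4) by simp
  define H where "H = (map_poly of_int h :: complex poly)"
  define Z where "Z = {z. poly H z = 0}"
  have Hz: "int_eval z h = 0" if "z \<in> Z" for z using that by (simp add: Z_def H_def int_eval_def)
  have H0: "H \<noteq> 0" using h(2) by (auto simp: H_def)
  have fin: "finite Z" unfolding Z_def using H0 by (rule poly_roots_finite)
  have pd: "poly (pderiv H) z = int_eval z (pderiv h)" for z
    by (simp add: H_def int_eval_def of_int_hom.map_poly_pderiv)
  have val: "int_eval z (pderiv h) * int_eval z v = of_int \<Delta>" if "z \<in> Z" for z
    using arg_cong[OF \<Delta>(2), of "int_eval z"] Hz[OF that] by (simp add: int_eval_const)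
  \<comment> \<open>At a multiple root both \<open>h\<close> and its derivative vanish, which the
    identity for \<open>\<Delta>\<close> forbids.\<close>
  have "rsquarefree H"
    unfolding rsquarefree_roots
  proof clarify
    fix a assume a: "poly H a = 0" "poly (pderiv H) a = 0"
    then have "of_int \<Delta> = (0 :: complex)" using val[of a] by (simp add: Z_def pd)
    then show False using \<Delta>(1) by simp
  qed
  then have "smult (lead_coeff H) (\<Prod>z\<in>Z. [:- z, 1:]) = H"
    unfolding Z_def by (rule complex_poly_decompose_rsquarefree)
  moreover have "lead_coeff H = 1" using h(2) by (simp add: H_def)
  ultimately have Hprod: "H = (\<Prod>z\<in>Z. [:- z, 1:])" by simp
  have card: "card Z = degree h"
    using arg_cong[OF Hprod, of degree] degree_prod_linear[of Z] by (simp add: H_def)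
  define l where "l \<gamma> = (\<Prod>z\<in>Z - {\<gamma>}. [:- z, 1:])" for \<gamma>
  have l_val: "poly (l \<gamma>) \<gamma> = int_eval \<gamma> (pderiv h)" if "\<gamma> \<in> Z" for \<gamma>
  proof -
    have H: "H = [:- \<gamma>, 1:] * l \<gamma>"
      unfolding Hprod l_def by (rule prod.remove[OF fin that])
    have "poly (pderiv H) \<gamma> = poly (l \<gamma>) \<gamma>"
      unfolding H pderiv_mult by (simp add: pderiv_pCons)
    then show ?thesis by (simp add: pd)
  qed
  have l_0: "poly (l \<gamma>) z = 0" if "z \<in> Z" "z \<noteq> \<gamma>" for \<gamma> z
    unfolding l_def poly_prod using that fin by (intro prod_zero) auto
  \<comment> \<open>This is the Lagrange coefficient \<open>\<Delta> * (r / D) / pderiv h\<close> at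
    \<open>\<gamma>\<close>. Since \<open>pderiv h * v\<close> equals \<open>\<Delta>\<close> there,
    the derivative disappears from the denominator and the coefficient is visibly integral.\<close>
  define e where "e \<gamma> = int_eval \<gamma> r / of_int D * int_eval \<gamma> v" for \<gamma>
  define T where "T = (\<Sum>\<gamma>\<in>Z. smult (e \<gamma>) (l \<gamma>))"
  define W where "W = smult (of_int \<Delta> / of_int D) (map_poly of_int r :: complex poly)"
  have T_val: "poly T z = poly W z" if "z \<in> Z" for z
  proof -
    have "poly T z = (\<Sum>\<gamma>\<in>Z. e \<gamma> * poly (l \<gamma>) z)" by (simp add: T_def poly_sum)
    also have "\<dots> = e z * poly (l z) z"
    proof -
      have "e \<gamma> * poly (l \<gamma>) z = 0" if "\<gamma> \<in> Z - {z}" for \<gamma>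
        using l_0[OF \<open>z \<in> Z\<close>, of \<gamma>] that by auto
      then have "(\<Sum>\<gamma>\<in>Z - {z}. e \<gamma> * poly (l \<gamma>) z) = 0" by (rule sum.neutral[rule_format])
      then show ?thesis unfolding sum.remove[OF fin that] by simp
    qed
    also have "\<dots> = int_eval z r / of_int D * (int_eval z (pderiv h) * int_eval z v)"
      by (simp add: e_def l_val[OF that])
    also have "\<dots> = poly W z" unfolding val[OF that] by (simp add: W_def int_eval_def)
    finally show ?thesis .
  qed
  have deg_T: "degree T < card Z"
    unfolding T_def
  proof (rule degree_sum_less)
    show "0 < card Z" using card h(3) by simp
    fix \<gamma> assume "\<gamma> \<in> Z"
    then have "card (Z - {\<gamma>}) < card Z" using fin by (meson card_Diff1_less)
    then show "degree (smult (e \<gamma>) (l \<gamma>)) < card Z"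
      unfolding l_def using degree_prod_linear[of "Z - {\<gamma>}"] degree_smult_le[of "e \<gamma>" "\<Prod>z\<in>Z - {\<gamma>}. [:- z, 1:]"] by linarith
  qed
  have deg_W: "degree W < card Z"
  proof -
    have "degree W \<le> degree r" unfolding W_def
      using degree_smult_le[of _ "map_poly of_int r :: complex poly"] by simp
    then show ?thesis using qr(2) h(3) unfolding card by auto
  qed
  \<comment> \<open>The two polynomials agree at \<open>card Z\<close> points and have smaller
    degree. One has algebraic integers as coefficients, the other rationals, so the common
    coefficients are integers.\<close>
  have TW: "T = W" using T_val deg_T deg_W by (rule poly_eqI_degree)
  have ai: "algebraic_int z" if "z \<in> Z" for z
    unfolding algebraic_int_altdef_ipoly using Hz[OF that] h(2) unfolding int_eval_def by blast
  have e_int: "algebraic_int (e \<gamma>)" if "\<gamma> \<in> Z" for \<gamma>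
    unfolding e_def
    by (rule algebraic_int_mult[OF algebraic_int_conjugate[OF h(1,3,4) D x(1) xr Hz[OF that]]])
      (simp add: int_eval_def algebraic_int_poly_of_int ai that)
  have l_int: "algebraic_int (coeff (l \<gamma>) i)" for \<gamma> i
    unfolding l_def by (rule algebraic_int_coeff_prod_linear) (simp add: ai)
  have "coeff W i \<in> \<int>" for i
  proof (rule rational_algebraic_int_is_int)
    have "coeff T i = (\<Sum>\<gamma>\<in>Z. e \<gamma> * coeff (l \<gamma>) i)" by (simp add: T_def coeff_sum)
    moreover have "algebraic_int \<dots>"
      by (rule algebraic_int_sum) (rule algebraic_int_mult[OF e_int l_int])
    ultimately show "algebraic_int (coeff W i)" unfolding TW by simp
    show "coeff W i \<in> \<rat>" by (simp add: W_def)
  qed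
  then have "poly W c \<in> int_evals c" by (rule int_coeff_poly_in_int_evals)
  moreover have "poly W c = of_int \<Delta> * x"
    using xr D by (simp add: W_def int_eval_def[symmetric] field_simps)
  ultimately show ?thesis by simp
qed

text \<open>The condition with \<open>D\<close> expresses that \<open>x\<close> lies in the field of
  \<open>c\<close>. All such \<open>x\<close> lie in \<open>\<int>[c]\<close> divided by one fixed
  \<open>\<Delta>\<close>, and reducing the coefficients of a representative of degree below
  \<open>degree h\<close> modulo \<open>\<Delta>\<close> leaves finitely many classes.\<close>

lemma int_evals_finite_cosets:
  assumes "algebraic_int c"
  shows "\<exists>T. finite T \<and> (\<forall>x D. algebraic_int x \<and> D \<noteq> 0 \<and> of_int D * x \<in> int_evals c
    \<longrightarrow> (\<exists>t\<in>T. x - t \<in> int_evals c))"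
proof -
  obtain h where h: "prime_elem h" "lead_coeff h = 1" "degree h > 0" "int_eval c h = 0"
    using algebraic_int_monic_prime_poly[OF assms] by blast
  have "pderiv h \<noteq> 0" using h(3) by (simp add: pderiv_eq_0_iff)
  then have "\<not> h dvd pderiv h"
    using dvd_imp_degree_le[of h "pderiv h"] h(3) by (auto simp: degree_pderiv)
  then obtain u v \<Delta> where \<Delta>: "\<Delta> \<noteq> 0" "h * u + pderiv h * v = [:\<Delta>:]"
    using prime_poly_bezout[OF h(1,3)] by blast
  let ?N = "degree h"
  define val where "val e = (\<Sum>i<?N. of_int (e i) * c ^ i) / of_int \<Delta>" for e :: "nat \<Rightarrow> int"
  define T where "T = val ` ({..<?N} \<rightarrow>\<^sub>E {0..<\<bar>\<Delta>\<bar>})"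
  have "finite T" unfolding T_def by (intro finite_imageI finite_PiE) auto
  moreover have "\<exists>t\<in>T. x - t \<in> int_evals c"
    if x: "algebraic_int x" and D: "D \<noteq> 0" and xD: "of_int D * x \<in> int_evals c" for x D
  proof -
    obtain f where f: "of_int \<Delta> * x = int_eval c f"
      using discriminant_mult_in_int_evals[OF h \<Delta> D x xD] by blast
    obtain q r where qr: "f = h * q + r" "r = 0 \<or> degree r < ?N"
      using monic_poly_division[OF h(2)] by blast
    have "int_eval c r = (\<Sum>i\<le>degree r. of_int (coeff r i) * c ^ i)" by (rule int_eval_altdef)
    also have "\<dots> = (\<Sum>i<?N. of_int (coeff r i) * c ^ i)"
      using qr(2) h(3) by (intro sum.mono_neutral_left) (auto simp: coeff_eq_0)
    finally have xr: "of_int \<Delta> * x = (\<Sum>i<?N. of_int (coeff r i) * c ^ i)" using f qr(1) h(4) by simp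
    define e where "e = (\<lambda>i\<in>{..<?N}. coeff r i mod \<bar>\<Delta>\<bar>)"
    have "val e \<in> T" unfolding T_def e_def using \<Delta>(1) by (intro imageI, subst restrict_PiE_iff) simp
    moreover have "x - val e \<in> int_evals c"
    proof -
      define s where "s i = (coeff r i - coeff r i mod \<bar>\<Delta>\<bar>) div \<Delta>" for i
      have s: "coeff r i - coeff r i mod \<bar>\<Delta>\<bar> = \<Delta> * s i" for i
      proof -
        have "\<bar>\<Delta>\<bar> dvd coeff r i - coeff r i mod \<bar>\<Delta>\<bar>" by (rule dvd_minus_mod)
        then have "\<Delta> dvd coeff r i - coeff r i mod \<bar>\<Delta>\<bar>" by (rule abs_dvd_iff[THEN iffD1])
        then show ?thesis by (simp add: s_def)
      qed
      have "of_int \<Delta> * (x - val e) = (\<Sum>i<?N. of_int (coeff r i) * c ^ i) - (\<Sum>i<?N. of_int (e i) * c ^ i)"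
        using \<Delta>(1) by (simp add: xr val_def right_diff_distrib)
      also have "\<dots> = (\<Sum>i<?N. of_int (coeff r i - coeff r i mod \<bar>\<Delta>\<bar>) * c ^ i)"
        unfolding sum_subtractf[symmetric] by (intro sum.cong refl) (simp add: e_def left_diff_distrib)
      also have "\<dots> = of_int \<Delta> * (\<Sum>i<?N. of_int (s i) * c ^ i)"
        unfolding s by (simp add: sum_distrib_left mult.assoc)
      finally have "x - val e = (\<Sum>i<?N. of_int (s i) * c ^ i)" using \<Delta>(1) by simp
      moreover have "c ^ i \<in> int_evals c" for i by (metis int_eval_X int_evals_power rangeI)
      ultimately show ?thesis by (simp add: int_evals_sum int_evals_mult int_evals_of_int)
    qed
    ultimately show ?thesis by blast
  qed
  ultimately show ?thesis by blast
qed

section \<open>Adjunctions and the index in terms of complex numbers\<close>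

lemma complex_field_simps:
  "carrier complex_field = UNIV" "x \<otimes>\<^bsub>complex_field\<^esub> y = x * y" "x \<oplus>\<^bsub>complex_field\<^esub> y = x + y"
  "\<one>\<^bsub>complex_field\<^esub> = 1" "\<zero>\<^bsub>complex_field\<^esub> = 0"
  by (simp_all add: ring_of_type_algebra_def)

lemma complex_field_a_inv: "\<ominus>\<^bsub>complex_field\<^esub> x = - x"
proof -
  interpret cring complex_field by (rule cring_from_type_algebra)
  show ?thesis by (rule minus_equality) (simp_all add: complex_field_simps)
qed

lemma complex_field_m_inv:
  assumes "x \<noteq> 0"
  shows "inv\<^bsub>complex_field\<^esub> x = inverse x"
proof -
  interpret field complex_field by (rule field_from_type_algebra)
  show ?thesis
    by (rule comm_inv_char) (use assms in \<open>simp_all add: complex_field_simps\<close>)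
qed

lemma int_adjoin_eq: "int_adjoin c = int_evals c"
proof
  show "int_adjoin c \<subseteq> int_evals c"
  proof
    fix x assume "x \<in> int_adjoin c"
    then show "x \<in> int_evals c" unfolding int_adjoin_def
    proof (induction rule: generate_ring.induct)
      case one
      show ?case using int_evals_of_int[of 1] by (simp add: complex_field_simps)
    next
      case (incl h)
      then show ?case by (metis int_eval_X rangeI singletonD)
    next
      case (a_inv h)
      then show ?case using int_evals_diff[OF int_evals_of_int[of 0] a_inv(2)] by (simp add: complex_field_a_inv)
    qed (simp_all add: complex_field_simps int_evals_add int_evals_mult)
  qed
  have int: "of_int i \<in> int_adjoin c" for i
  proof (induction i rule: int_induct[where k = 0])
    case base
    have "1 + - 1 \<in> int_adjoin c"
      unfolding int_adjoin_def
      using generate_ring.eng_add[OF generate_ring.one generate_ring.a_inv[OF generate_ring.one], of complex_field "{c}"]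
      by (simp add: complex_field_simps complex_field_a_inv)
    then show ?case by simp
  next
    case (step1 i)
    then show ?case unfolding int_adjoin_def
      using generate_ring.eng_add[OF _ generate_ring.one, of "of_int i" complex_field "{c}"]
      by (simp add: complex_field_simps)
  next
    case (step2 i)
    then show ?case unfolding int_adjoin_def
      using generate_ring.eng_add[OF _ generate_ring.a_inv[OF generate_ring.one], of "of_int i" complex_field "{c}"]
      by (simp add: complex_field_simps complex_field_a_inv)
  qed
  have "int_eval c f \<in> int_adjoin c" for f
  proof (induction f)
    case 0
    then show ?case using int[of 0] by simp
  next
    case (pCons a f)
    have eq: "int_eval c (pCons a f) = of_int a + c * int_eval c f" by (simp add: int_eval_def hom_distribs)
    have "c \<in> generate_ring complex_field {c}" by (rule generate_ring.incl) simp
    then show ?case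
      using pCons(2) int[of a]
        generate_ring.eng_add[OF _ generate_ring.eng_mult, of "of_int a" complex_field "{c}" c "int_eval c f"]
      unfolding eq int_adjoin_def complex_field_simps by blast
  qed
  then show "int_evals c \<subseteq> int_adjoin c" by blast
qed

text \<open>Only inversion needs an argument: the numerator polynomial is not divisible by the prime
  polynomial \<open>h\<close> of \<open>c\<close>, so a Bezout identity makes some polynomial
  multiple of it a nonzero integer at \<open>c\<close>.\<close>

lemma rat_adjoin_int_multiple:
  assumes c: "algebraic_int c" and x: "x \<in> rat_adjoin c"
  shows "\<exists>D. D \<noteq> 0 \<and> of_int D * x \<in> int_evals c"
  using x unfolding rat_adjoin_def
proof (induction rule: generate_field.induct)
  case one
  show ?case using int_evals_of_int[of 1] by (intro exI[of _ 1]) (simp add: complex_field_simps)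
next
  case (incl h)
  then show ?case by (intro exI[of _ 1]) (metis int_eval_X mult_1 of_int_1 rangeI singletonD zero_neq_one)
next
  case (a_inv h)
  then obtain D where "D \<noteq> 0" "of_int D * h \<in> int_evals c" by blast
  then show ?case using int_evals_diff[OF int_evals_of_int[of 0], of "of_int D * h" c]
    by (intro exI[of _ D]) (simp add: complex_field_a_inv)
next
  case (m_inv x)
  then obtain D f where D: "D \<noteq> 0" "of_int D * x = int_eval c f" by blast
  have x0: "x \<noteq> 0" using m_inv by (simp add: complex_field_simps)
  obtain h where h: "prime_elem h" "degree h > 0" "int_eval c h = 0"
    using algebraic_int_monic_prime_poly[OF c] by blast
  have "int_eval c f \<noteq> 0" using D x0 by (metis mult_eq_0_iff of_int_eq_0_iff)
  then have "\<not> h dvd f" using h(3) by (auto elim!: dvdE)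
  then obtain u v E where E: "E \<noteq> 0" "h * u + f * v = [:E:]"
    using prime_poly_bezout[OF h(1,2)] by blast
  have "int_eval c f * int_eval c v = of_int E"
    using arg_cong[OF E(2), of "int_eval c"] h(3) by (simp add: int_eval_const)
  then have "of_int E * inverse x = of_int D * int_eval c v"
    unfolding D(2)[symmetric] using x0 by (simp add: field_simps)
  then have "of_int E * inverse x \<in> int_evals c"
    by (simp add: int_evals_mult int_evals_of_int)
  then show ?case using E(1) complex_field_m_inv[OF x0] by auto
next
  case (eng_add x y)
  then obtain D E where D: "D \<noteq> 0" "of_int D * x \<in> int_evals c"
    and E: "E \<noteq> 0" "of_int E * y \<in> int_evals c" by blast
  have "of_int E * (of_int D * x) + of_int D * (of_int E * y) \<in> int_evals c"
    by (rule int_evals_add[OF int_evals_mult[OF int_evals_of_int D(2)] int_evals_mult[OF int_evals_of_int E(2)]])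
  then have "of_int (D * E) * (x + y) \<in> int_evals c" by (simp add: algebra_simps)
  then show ?case using D E unfolding complex_field_simps by (metis mult_eq_0_iff)
next
  case (eng_mult x y)
  then obtain D E where D: "D \<noteq> 0" "of_int D * x \<in> int_evals c"
    and E: "E \<noteq> 0" "of_int E * y \<in> int_evals c" by blast
  have "(of_int D * x) * (of_int E * y) \<in> int_evals c" by (rule int_evals_mult[OF D(2) E(2)])
  then have "of_int (D * E) * (x * y) \<in> int_evals c" by (simp add: ac_simps)
  then show ?case using D E unfolding complex_field_simps by (metis mult_eq_0_iff)
qed

text \<open>The set \<open>T\<close> makes the quotient group finite, so if \<open>p\<close> divides
  its order, Sylow's theorem with exponent 1, that is Cauchy's theorem, gives a subgroup of order
  \<open>p\<close>. A nontrivial coset in it is represented by some \<open>y\<close> outside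
  \<open>B\<close> with \<open>p * y\<close> in \<open>B\<close>, against
  \<open>sat\<close>.\<close>

lemma prime_not_dvd_add_index:
  assumes p: "prime p"
    and A: "0 \<in> A" "\<And>x y. x \<in> A \<Longrightarrow> y \<in> A \<Longrightarrow> x + y \<in> A" "\<And>x. x \<in> A \<Longrightarrow> - x \<in> A"
    and B: "B \<subseteq> A" "0 \<in> B" "\<And>x y. x \<in> B \<Longrightarrow> y \<in> B \<Longrightarrow> x + y \<in> B" "\<And>x. x \<in> B \<Longrightarrow> - x \<in> B"
    and T: "finite T" "\<And>x. x \<in> A \<Longrightarrow> \<exists>t\<in>T. x - t \<in> B"
    and sat: "\<And>x. x \<in> A \<Longrightarrow> of_nat p * x \<in> B \<Longrightarrow> x \<in> B"
  shows "\<not> p dvd add_index A B"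
proof
  assume dvd: "p dvd add_index A B"
  define G where "G = add_monoid (complex_field\<lparr>carrier := A\<rparr>)"
  have G: "carrier G = A" "\<And>x y. x \<otimes>\<^bsub>G\<^esub> y = x + y" "\<one>\<^bsub>G\<^esub> = 0"
    by (simp_all add: G_def complex_field_simps)
  interpret G: comm_group G
  proof (rule comm_groupI)
    fix x assume "x \<in> carrier G"
    then show "\<exists>y\<in>carrier G. y \<otimes>\<^bsub>G\<^esub> x = \<one>\<^bsub>G\<^esub>" using A(3) by (auto simp: G intro!: bexI[of _ "- x"])
  qed (auto simp: G A)
  have inv: "inv\<^bsub>G\<^esub> x = - x" if "x \<in> A" for x
    using that A(3) by (intro G.inv_equality) (simp_all add: G)
  have sub: "subgroup B G"
    using B inv by (intro G.subgroupI) (auto simp: G subset_iff)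
  interpret N: normal B G using G.normal_iff_subgroup sub by simp
  have coset: "B #>\<^bsub>G\<^esub> x = (\<lambda>b. b + x) ` B" for x by (auto simp: r_coset_def G)
  have coset_eq: "B #>\<^bsub>G\<^esub> x = (\<lambda>b. b + t) ` B" if "x - t \<in> B" for x t
  proof (intro Set.set_eqI iffI)
    fix z assume "z \<in> B #>\<^bsub>G\<^esub> x"
    then obtain b where b: "b \<in> B" "z = b + x" unfolding coset by blast
    then have "z = (b + (x - t)) + t" by simp
    then show "z \<in> (\<lambda>b. b + t) ` B" using B(3)[OF b(1) that] by blast
  next
    fix z assume "z \<in> (\<lambda>b. b + t) ` B"
    then obtain b where b: "b \<in> B" "z = b + t" by blast
    then have "z = (b + - (x - t)) + x" by simp
    then show "z \<in> B #>\<^bsub>G\<^esub> x" unfolding coset using B(3)[OF b(1) B(4)[OF that]] by blast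
  qed
  have "rcosets\<^bsub>G\<^esub> B \<subseteq> (\<lambda>t. (\<lambda>b. b + t) ` B) ` T"
  proof
    fix Y assume "Y \<in> rcosets\<^bsub>G\<^esub> B"
    then obtain x where x: "x \<in> A" "Y = B #>\<^bsub>G\<^esub> x" by (auto simp: RCOSETS_def G)
    then show "Y \<in> (\<lambda>t. (\<lambda>b. b + t) ` B) ` T" using T(2)[OF x(1)] coset_eq by blast
  qed
  then have fin: "finite (rcosets\<^bsub>G\<^esub> B)" using T(1) finite_subset by blast
  define Q where "Q = G Mod B"
  have Q: "carrier Q = rcosets\<^bsub>G\<^esub> B" "\<one>\<^bsub>Q\<^esub> = B" by (simp_all add: Q_def FactGroup_def)
  interpret Q: group Q unfolding Q_def by (rule N.factorgroup_is_group)
  have "add_index A B = Coset.order Q"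
    by (simp add: add_index_def Coset.order_def Q A_RCOSETS_def G_def)
  then obtain k where k: "Coset.order Q = p ^ 1 * k" using dvd by auto
  have finQ: "finite (carrier Q)" unfolding Q by (rule fin)
  obtain H where H: "subgroup H Q" "card H = p ^ 1"
    using sylow_thm[OF p Q.is_group k finQ] by blast
  have "card H \<noteq> 1" using H(2) p by auto
  moreover have "B \<in> H" using subgroup.one_closed[OF H(1)] by (simp add: Q)
  ultimately have "H \<noteq> {B}" by auto
  then obtain Y where Y: "Y \<in> H" "Y \<noteq> B" using \<open>B \<in> H\<close> by blast
  have YQ: "Y \<in> carrier Q" using subgroup.mem_carrier[OF H(1) Y(1)] .
  then obtain y where y: "y \<in> A" "Y = B #>\<^bsub>G\<^esub> y" unfolding Q by (auto simp: RCOSETS_def G)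
  have pow: "Y [^]\<^bsub>Q\<^esub> n = B #>\<^bsub>G\<^esub> (of_nat n * y) \<and> of_nat n * y \<in> A" for n :: nat
  proof (induction n)
    case 0
    have "B #>\<^bsub>G\<^esub> 0 = B" by (simp add: coset)
    then show ?case using A(1) by (simp add: Q)
  next
    case (Suc n)
    have "Y [^]\<^bsub>Q\<^esub> Suc n = (B #>\<^bsub>G\<^esub> (of_nat n * y)) <#>\<^bsub>G\<^esub> (B #>\<^bsub>G\<^esub> y)"
      using Suc y(2) by (simp add: Q_def FactGroup_def)
    also have "\<dots> = B #>\<^bsub>G\<^esub> (of_nat n * y + y)"
      using N.rcos_sum[of "of_nat n * y" y] Suc y(1) by (simp add: G)
    finally show ?case using A(2)[of "of_nat n * y" y] Suc y(1) by (simp add: algebra_simps)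
  qed
  interpret H: group "Q\<lparr>carrier := H\<rparr>" using H(1) by (rule Q.subgroup_imp_group)
  have "finite H" using H(1) finQ by (meson finite_subset subgroup.subset)
  then have "Y [^]\<^bsub>Q\<lparr>carrier := H\<rparr>\<^esub> p = \<one>\<^bsub>Q\<^esub>"
    using H.pow_order_eq_1[of Y] Y(1) H(2) by (simp add: Coset.order_def)
  then have "Y [^]\<^bsub>Q\<^esub> p = B" by (simp add: Q flip: Q.nat_pow_consistent)
  then have "(\<lambda>b. b + of_nat p * y) ` B = B" using pow[of p] coset by simp
  then have "of_nat p * y \<in> B" using B(2) by force
  then have "y \<in> B" using sat y(1) by blast
  then have "Y = (\<lambda>b. b + 0) ` B" unfolding y(2) by (intro coset_eq) simp
  then show False using Y(2) by simp
qed

theorem theorem1p9: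
  fixes d m n :: nat and c0 :: complex
  assumes "prime d" and "m \<ge> 2" and "n \<ge> 1"
    and "poly (map_poly of_int (G_poly d m n)) c0 = 0"
  shows "\<not> d dvd add_index (ring_of_integers (rat_adjoin c0)) (int_adjoin c0)"
proof -
  have d: "prime d" "d \<ge> 2" and n: "n > 0" and m: "m > 0"
    using assms prime_ge_2_nat by auto
  have G: "int_eval c0 (G_poly d m n) = 0" using assms(4) by (simp add: int_eval_def)
  \<comment> \<open>Integrality of \<open>c0\<close> is read off from the monic multiple
    \<open>orbit_diff d m n\<close> of \<open>G_poly d m n\<close>.\<close>
  then have "int_eval c0 (orbit_diff d m n) = 0"
    using G_poly_dvd[OF d(2) n m] by (auto elim!: dvdE)
  then have c: "algebraic_int c0"
    unfolding algebraic_int_altdef_ipoly int_eval_def using orbit_diff_monic(2)[OF d(2) n] by blast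
  obtain E where E: "primitive_factor d 0 n ^ E \<in> ideal2 (of_nat d) (G_poly d m n)"
    using primitive_power_in_ideal_G_poly[OF d(1) n m] by blast
  obtain R where R: "unit_mod (ideal2 (of_nat d) (primitive_factor d 0 n)) R"
      "of_nat d * R \<in> ideal2 (G_poly d m n) (primitive_factor d 0 n)"
    using prime_unit_in_ideal_G_poly[OF d(1) n assms(2)] by blast
  \<comment> \<open>This fact supplies the hypothesis \<open>sat\<close> of
    \<open>prime_not_dvd_add_index\<close>, while \<open>T\<close> below supplies the
    finiteness.\<close>
  note saturated = int_evals_p_saturated[OF d(1) n c G E R X_power_minus_X_in_ideal[OF d(1) n]]
  obtain T where T: "finite T" "\<And>x D. algebraic_int x \<Longrightarrow> D \<noteq> 0 \<Longrightarrow> of_int D * x \<in> int_evals c0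
      \<Longrightarrow> \<exists>t\<in>T. x - t \<in> int_evals c0"
    using int_evals_finite_cosets[OF c] by blast
  have zero: "0 \<in> int_evals c0" using int_evals_of_int[of 0] by simp
  have adjoin: "int_evals c0 \<subseteq> rat_adjoin c0"
  proof
    fix x assume "x \<in> int_evals c0"
    then have "x \<in> generate_ring complex_field {c0}" by (simp add: int_adjoin_eq[symmetric] int_adjoin_def)
    then show "x \<in> rat_adjoin c0" unfolding rat_adjoin_def
      by induction (auto intro: generate_field.intros)
  qed
  have K: "x + y \<in> rat_adjoin c0" "- x \<in> rat_adjoin c0"
    if "x \<in> rat_adjoin c0" "y \<in> rat_adjoin c0" for x y
    using generate_field.eng_add[of x complex_field "{c0}" y] generate_field.a_inv[of x complex_field "{c0}"] that
    by (simp_all add: rat_adjoin_def complex_field_simps complex_field_a_inv)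
  show ?thesis unfolding int_adjoin_eq
  proof (rule prime_not_dvd_add_index[OF d(1)])
    show "int_evals c0 \<subseteq> ring_of_integers (rat_adjoin c0)"
      using adjoin algebraic_int_poly_of_int[OF c] by (auto simp: ring_of_integers_def int_eval_def)
    then show "0 \<in> ring_of_integers (rat_adjoin c0)" using zero by blast
    show "x + y \<in> ring_of_integers (rat_adjoin c0)"
      if "x \<in> ring_of_integers (rat_adjoin c0)" "y \<in> ring_of_integers (rat_adjoin c0)" for x y
      using that by (simp add: ring_of_integers_def K algebraic_int_add)
    show "- x \<in> ring_of_integers (rat_adjoin c0)" if "x \<in> ring_of_integers (rat_adjoin c0)" for x
      using that K(2)[of x x] by (simp add: ring_of_integers_def)
    show "- x \<in> int_evals c0" if "x \<in> int_evals c0" for x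
      using int_evals_diff[OF zero that] by simp
    show "\<exists>t\<in>T. x - t \<in> int_evals c0" if "x \<in> ring_of_integers (rat_adjoin c0)" for x
      using that rat_adjoin_int_multiple[OF c, of x] T(2)[of x] by (auto simp: ring_of_integers_def)
    show "x \<in> int_evals c0"
      if "x \<in> ring_of_integers (rat_adjoin c0)" "of_nat d * x \<in> int_evals c0" for x
      using that saturated by (simp add: ring_of_integers_def)
  qed (use T(1) zero int_evals_add in auto)
qed

end
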